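(* Let $\{U_i\}_{i\ge1}$ be a sequence of independent uniformly distributed random variables on $\mathbb S^{d-1}$, and let $L>0$. Then $$E\bigl(\|S_{U_1\dots U_n}f-f^*\|_1\bigr)\le 2d\,m(B_{2L})\,\|f\|_\infty\,n^{-1}$$ for every $n\ge1$ and every nonnegative bounded measurable function $f$ on $\mathbb R^d$ with support in $B_L$. If $f$ is Hölder continuous with modulus of continuity $\eta(\delta)\le c\,\delta^\alpha$ for some $\alpha\in(0,1]$ and $c>0$, then $$E\bigl(\|S_{U_1\dots U_n}f-f^*\|_\infty\bigr)\le 10\,c\,L^\alpha\,n^{-\frac{\alpha}{d+\alpha}} .$$
   Context: $m$ is Lebesgue measure on $\mathbb R^d$, and $B_\rho$ is the ball of radius $\rho$ centered at the origin. $\eta(\delta)=\sup_{|x-y|\le\delta}|f(x)-f(y)|$ is the modulus of continuity of $f$. For $A$ of finite volume, $A^*$ is the open ball centered at the origin with $m(A^* )=m(A)$; $f^*$ is the lower semicontinuous radially decreasing function with $\{f^*>t\}=\{f>t\}^*$ for all $t>0$ (symmetric decreasing rearrangement). For $u\in\mathbb S^{d-1}$, the Steiner symmetrization $S_uf$ replaces the restriction of $f$ to each line $\{\xi+tu:t\in\mathbb R\}$, $\xi\perp u$, by its one-dimensional symmetric decreasing rearrangement in $t$; if the restriction to such a line is not measurable or does not decay at infinity, $S_uf$ is set equal to zero on this line. Set $S_{u_1\dots u_n}=S_{u_n}\circ\dots\circ S_{u_1}$. *)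

theory Defs
  imports "HOL-Probability.Probability"
begin

text \<open>
  The set \<open>A\<^sup>*\<close>: the open ball about the origin with the (finite) volume of \<open>A\<close>.
  In dimension one it is an open interval centered at 0, so the same definition serves
  for the rearrangement on \<open>\<real>\<^sup>d\<close> and for the rearrangement along a line.
\<close>

definition set_rearr :: "'a::euclidean_space set \<Rightarrow> 'a set" where
  "set_rearr A = (THE B. \<exists>r\<ge>0. B = ball 0 r \<and> emeasure lebesgue B = emeasure lebesgue A)"

text \<open>
  The symmetric decreasing rearrangement \<open>f\<^sup>*\<close> of a nonnegative function \<open>f\<close>. The superlevel
  sets for \<open>t > 0\<close> determine \<open>g\<close> only up to its nonpositive values, hence the explicit
  condition \<open>0 \<le> g x\<close>. As functions are real-valued, \<open>g\<close> exists (for measurable \<open>f\<close> that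
  vanish at infinity) only if \<open>f\<close> is essentially bounded.
\<close>

definition symm_rearr :: "('a::euclidean_space \<Rightarrow> real) \<Rightarrow> 'a \<Rightarrow> real" where
  "symm_rearr f = (THE g.
     (\<forall>x. 0 \<le> g x) \<and>
     (\<forall>t. open {x. t < g x}) \<and>
     (\<forall>x y. norm x \<le> norm y \<longrightarrow> g y \<le> g x) \<and>
     (\<forall>t>0. {x. t < g x} = set_rearr {x. t < f x}))"

definition vanishes_at_infinity :: "('a::euclidean_space \<Rightarrow> real) \<Rightarrow> bool" where
  "vanishes_at_infinity f \<longleftrightarrow> (\<forall>t>0. emeasure lebesgue {x. t < f x} < \<infinity>)"

text \<open>
  \<open>S\<^sub>u f\<close> for a unit vector \<open>u\<close>. The point \<open>x\<close> lies on the line \<open>{\<xi> + t u}\<close> with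
  \<open>\<xi> = x - (x \<bullet> u) u\<close> orthogonal to \<open>u\<close>, at parameter \<open>t = x \<bullet> u\<close>.
\<close>

definition steiner :: "'a::euclidean_space \<Rightarrow> ('a \<Rightarrow> real) \<Rightarrow> 'a \<Rightarrow> real" where
  "steiner u f x =
     (let \<xi> = x - (x \<bullet> u) *\<^sub>R u;
          h = (\<lambda>t::real. f (\<xi> + t *\<^sub>R u))
      in if h \<in> borel_measurable lebesgue \<and> vanishes_at_infinity h
         then symm_rearr h (x \<bullet> u) else 0)"

text \<open>\<open>steiner_iter [u\<^sub>1, \<dots>, u\<^sub>n]\<close> applies \<open>S\<close> in direction \<open>u\<^sub>1\<close> first and \<open>u\<^sub>n\<close> last.\<close>

definition steiner_iter :: "'a::euclidean_space list \<Rightarrow> ('a \<Rightarrow> real) \<Rightarrow> 'a \<Rightarrow> real" where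
  "steiner_iter us f = fold steiner us f"

text \<open>
  The uniform distribution on the unit sphere, as the law of \<open>x / |x|\<close> for \<open>x\<close> uniformly
  distributed in the unit ball; this is normalized surface measure. Since \<open>sgn 0 = 0\<close>,
  the restriction to the sphere discards a null set.
\<close>

definition uniform_sphere :: "'a::euclidean_space measure" where
  "uniform_sphere =
     restrict_space (distr (uniform_measure lborel (ball 0 1)) borel sgn) (sphere 0 1)"

definition L1_norm :: "('a::euclidean_space \<Rightarrow> real) \<Rightarrow> ennreal" where
  "L1_norm f = (\<integral>\<^sup>+x. ennreal \<bar>f x\<bar> \<partial>lebesgue)"

definition Linf_norm :: "('a::euclidean_space \<Rightarrow> real) \<Rightarrow> ennreal" where
  "Linf_norm f = esssup lebesgue (\<lambda>x. ennreal \<bar>f x\<bar>)"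

definition modulus_of_continuity :: "('a::euclidean_space \<Rightarrow> real) \<Rightarrow> real \<Rightarrow> ennreal" where
  "modulus_of_continuity f \<delta> =
     (SUP (x, y) \<in> {(x, y). norm (x - y) \<le> \<delta>}. ennreal \<bar>f x - f y\<bar>)"

end

theory Submission
  imports Defs
begin

text \<open>
  Fix a level \<open>t > 0\<close> and compare \<open>A = {f > t}\<close> with the ball \<open>B = {f\<^sup>* > t}\<close>. On a line in
  direction \<open>u\<close> the symmetrized level set and \<open>B\<close> are both intervals centered at the same point,
  hence nested; if \<open>a\<close> and \<open>b\<close> are the lengths of \<open>B - A\<close> and \<open>A - B\<close> on that line, the
  symmetrization lowers \<open>a + b\<close> to \<open>\<bar>a - b\<bar> \<le> a + b - a b / L\<close>. Integrating \<open>a b\<close> over all lines and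
  averaging over \<open>u\<close> in polar coordinates yields at least a constant multiple of
  \<open>m (B - A) m (A - B)\<close>. So the expected symmetric difference \<open>q\<^sub>n\<close> satisfies
  \<open>q\<^bsub>n+1\<^esub> \<le> q\<^sub>n - q\<^sub>n\<^sup>2 / K\<close> with \<open>K = d m(B\<^bsub>2L\<^esub>)\<close>, whence \<open>q\<^sub>n \<le> K / n\<close>; integrating over
  \<open>t\<close> bounds the \<open>L\<^sup>1\<close> distance. Steiner symmetrization preserves a Hoelder modulus, and \<open>f\<^sup>*\<close>
  inherits it as an almost everywhere limit; hence the sup distance is at most \<open>2 c \<rho>\<^sup>\<alpha>\<close> plus the \<open>L\<^sup>1\<close> distance
  divided by \<open>m(B\<^sub>\<rho>)\<close>, for every \<open>\<rho> > 0\<close>.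
\<close>

section \<open>Symmetric decreasing rearrangement\<close>

text \<open>Two obstacles shape the proof. The recursion is quadratic, so it is run at one fixed
  level \<open>t\<close>: Jensen's inequality replaces the mean of the squared defect by the square
  of the mean, and the levels are integrated only at the end. Moreover \<open>steiner\<close> tests
  measurability line by line, and for a Lebesgue measurable \<open>f\<close> the test may fail on
  exceptional lines, which is awkward for measurability in the random directions. The work is
  therefore done with Borel functions and carried over to \<open>f\<close> through equality almost
  everywhere.

  Origin of \<open>K\<close>: as \<open>A\<close> and \<open>B\<close> have equal volume, each of
  the two differences has volume \<open>q / 2\<close>. Chords have length at most
  \<open>2 L\<close>, whence the factor \<open>1 / L\<close>. With \<open>v\<close> the volume of
  the unit ball, a random line through a point sees a set with density
  \<open>2 / (d v |y|^(d-1))\<close> in the displacement \<open>y\<close>, which is at least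
  \<open>4 L / K\<close> for \<open>|y| <= 2 L\<close>. The product
  \<open>(1 / L) (4 L / K) (q / 2)^2\<close> is \<open>q^2 / K\<close>.\<close>

definition ball_vol :: "'a::euclidean_space \<Rightarrow> ennreal" where
  "ball_vol x = emeasure lborel (ball (0::'a) (norm x))"

lemma ball_vol_eq:
  "ball_vol (x::'a::euclidean_space) = ennreal (unit_ball_vol (real DIM('a)) * norm x ^ DIM('a))"
  by (simp add: ball_vol_def emeasure_ball)

lemma ball_vol_real: "ball_vol (s::real) = ennreal (2 * \<bar>s\<bar>)"
  by (simp add: ball_vol_eq)

lemma ball_vol_mono:
  fixes x y :: "'a::euclidean_space"
  shows "norm x \<le> norm y \<Longrightarrow> ball_vol x \<le> ball_vol y"
  unfolding ball_vol_def by (intro emeasure_mono) auto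

lemma ball_vol_less_iff:
  fixes x :: "'a::euclidean_space"
  assumes "0 \<le> r"
  shows "ball_vol x < emeasure lborel (ball (0::'a) r) \<longleftrightarrow> norm x < r"
proof -
  have "unit_ball_vol (real DIM('a)) > 0" by simp
  then show ?thesis
    using assms power_mono_iff [OF assms norm_ge_zero [of x], of "DIM('a)"]
    by (simp add: ball_vol_eq emeasure_ball ennreal_less_iff linorder_not_le [symmetric])
qed

lemma continuous_ball_vol: "continuous_on UNIV (ball_vol :: 'a::euclidean_space \<Rightarrow> ennreal)"
  unfolding ball_vol_eq [abs_def]
  by (intro continuous_on_compose2 [OF continuous_on_ennreal] continuous_intros) auto

lemma ex_ball_emeasure_eq:
  assumes "c < (\<infinity>::ennreal)"
  obtains r where "0 \<le> r" "emeasure lborel (ball (0::'a::euclidean_space) r) = c"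
proof
  define v where "v = unit_ball_vol (real DIM('a))"
  have v: "v > 0" by (simp add: v_def)
  define r where "r = root DIM('a) (enn2real c / v)"
  show "0 \<le> r" using v by (simp add: r_def)
  have "r ^ DIM('a) = enn2real c / v"
    unfolding r_def using v by (intro real_root_pow_pos2) auto
  then show "emeasure lborel (ball (0::'a) r) = c"
    using v \<open>0 \<le> r\<close> assms by (simp add: emeasure_ball v_def [symmetric])
qed

text \<open>Stated through volumes instead of a radius: a point lies in a centered open ball exactly
  when the ball reaching up to that point has smaller volume. The same observation makes the ball in
  the definition unique.\<close>

lemma set_rearr_eq:
  fixes A :: "'a::euclidean_space set"
  assumes "emeasure lebesgue A < \<infinity>"
  shows "set_rearr A = {x. ball_vol x < emeasure lebesgue A}"
proof -
  obtain r where r: "0 \<le> r" "emeasure lborel (ball (0::'a) r) = emeasure lebesgue A"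
    using ex_ball_emeasure_eq [OF assms] by metis
  have "B = ball (0::'a) r"
    if "\<exists>r'\<ge>0. B = ball 0 r' \<and> emeasure lebesgue B = emeasure lebesgue A" for B
  proof -
    from that obtain r' where r': "0 \<le> r'" "B = ball 0 r'"
      "emeasure lborel (ball (0::'a) r') = emeasure lebesgue A" by auto
    have "norm x < r \<longleftrightarrow> norm x < r'" for x :: 'a
      using ball_vol_less_iff [OF r(1)] ball_vol_less_iff [OF r'(1)] r(2) r'(3) by metis
    then show ?thesis using r' by auto
  qed
  then have "set_rearr A = ball 0 r"
    unfolding set_rearr_def using r by (intro the_equality) auto
  moreover have "ball (0::'a) r = {x. ball_vol x < emeasure lebesgue A}"
    unfolding r(2) [symmetric] ball_vol_less_iff [OF r(1)] by (auto simp: mem_ball)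
  ultimately show ?thesis by simp
qed

lemma symm_rearr_cong:
  assumes "\<And>t. 0 < t \<Longrightarrow> emeasure lebesgue {x. t < f x} = emeasure lebesgue {x. t < g x}"
  shows "symm_rearr f = symm_rearr g"
proof -
  have "set_rearr {x. t < f x} = set_rearr {x. t < g x}" if "0 < t" for t
    unfolding set_rearr_def by (simp add: assms [OF that])
  then show ?thesis
    unfolding symm_rearr_def by (intro arg_cong [where f = The] ext) auto
qed

text \<open>The setting in which the description in \<open>symm_rearr\<close> has a solution; the
  bound \<open>C\<close> keeps it real-valued. It is instantiated both on the whole space and, for
  Steiner symmetrization, on \<open>real\<close>.\<close>

locale bounded_vanishing =
  fixes f :: "'a::euclidean_space \<Rightarrow> real" and C :: real
  assumes meas [measurable]: "f \<in> borel_measurable lebesgue"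
    and bdd: "\<And>x. f x \<le> C" "0 \<le> C"
    and van: "vanishes_at_infinity f"
begin

definition lev :: "real \<Rightarrow> ennreal" where
  "lev t = emeasure lebesgue {x. t < f x}"

lemma lev_fin: "0 < t \<Longrightarrow> lev t < \<infinity>"
  using van by (auto simp: vanishes_at_infinity_def lev_def)

lemma lev_sets [measurable]: "{x. t < f x} \<in> sets lebesgue"
proof -
  have "{x \<in> space lebesgue. t < f x} \<in> sets lebesgue" by measurable
  then show ?thesis by simp
qed

lemma lev_antimono: "s \<le> t \<Longrightarrow> lev t \<le> lev s"
  unfolding lev_def by (intro emeasure_mono lev_sets) auto

text \<open>Continuity of measure from below along the levels \<open>t + 1 / (n + 1)\<close>. This
  right-continuity is what gives strict inequalities on both sides of
  \<open>symm_rearr_less_iff\<close>.\<close>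

lemma lev_right_cont:
  assumes "c < lev t"
  shows "\<exists>s>t. c < lev s"
proof -
  have eq: "{x. t < f x} = (\<Union>n. {x. t + 1 / real (Suc n) < f x})"
  proof (safe, goal_cases)
    case (1 x)
    then obtain n where "1 / real (Suc n) < f x - t"
      using nat_approx_posE [of "f x - t"] by auto
    then show ?case by (auto simp: algebra_simps)
  next
    case (2 x n)
    have "0 < 1 / real (Suc n)" by simp
    with 2 show ?case by linarith
  qed
  have "lev t = (SUP n. lev (t + 1 / real (Suc n)))"
    unfolding lev_def eq
  proof (intro SUP_emeasure_incseq [symmetric])
    show "incseq (\<lambda>n. {x. t + 1 / real (Suc n) < f x})"
    proof (intro incseq_SucI subsetI, safe)
      fix n x assume "t + 1 / real (Suc n) < f x"
      moreover have "1 / real (Suc (Suc n)) \<le> 1 / real (Suc n)" by (simp add: frac_le)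
      ultimately show "t + 1 / real (Suc (Suc n)) < f x" by linarith
    qed
  qed (use lev_sets in auto)
  with assms obtain n where "c < lev (t + 1 / real (Suc n))"
    by (auto simp: less_SUP_iff)
  then show ?thesis by (intro exI [of _ "t + 1 / real (Suc n)"]) auto
qed

text \<open>The solution is the supremum of all levels whose ball contains \<open>x\<close>. It is
  unique because a nonnegative function is determined by its superlevel sets at positive
  levels.\<close>

lemma symm_rearr_props:
  shows symm_rearr_nonneg: "0 \<le> symm_rearr f x"
    and symm_rearr_less_iff: "0 < t \<Longrightarrow> t < symm_rearr f x \<longleftrightarrow> ball_vol x < lev t"
    and symm_rearr_open: "open {x. t < symm_rearr f x}"
proof -
  \<comment> \<open>The inserted 0 keeps the set nonempty and gives the value 0 where no positive
    level qualifies.\<close>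
  define T where "T x = insert 0 {t. 0 < t \<and> ball_vol x < lev t}" for x :: 'a
  define g where "g x = Sup (T x)" for x :: 'a
  have T_le: "t \<le> C" if "t \<in> T x" for t x
  proof (rule ccontr)
    assume "\<not> t \<le> C"
    then have "{x. t < f x} = {}" using bdd by (force simp: not_less intro: order_trans)
    then show False using that bdd \<open>\<not> t \<le> C\<close> by (auto simp: T_def lev_def)
  qed
  have bdd_T: "bdd_above (T x)" for x by (rule bdd_aboveI) (rule T_le)
  have T0: "0 \<in> T x" for x by (simp add: T_def)
  have g_nonneg: "0 \<le> g x" for x
    unfolding g_def using T0 bdd_T by (intro cSup_upper)
  have g_less: "t < g x \<longleftrightarrow> ball_vol x < lev t" if "0 < t" for t x
  proof
    assume "t < g x"
    then obtain s where "s \<in> T x" "t < s"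
      unfolding g_def using T0 by (subst (asm) less_cSup_iff [OF _ bdd_T]) auto
    then show "ball_vol x < lev t"
      using that lev_antimono [of t s] by (auto simp: T_def)
  next
    assume "ball_vol x < lev t"
    then obtain s where "s > t" "ball_vol x < lev s" using lev_right_cont by blast
    then have "s \<in> T x" using that by (auto simp: T_def)
    then have "s \<le> g x" unfolding g_def using bdd_T by (intro cSup_upper)
    then show "t < g x" using \<open>s > t\<close> by simp
  qed
  have ball_vol_open: "open {x::'a. ball_vol x < c}" for c
    using continuous_ball_vol by (intro open_Collect_less) (auto intro: continuous_intros)
  have op: "open {x. t < g x}" for t
  proof -
    consider "t < 0" | "t = 0" | "0 < t" by linarith
    then show ?thesis
    proof cases
      case 1
      then have "{x. t < g x} = UNIV" using g_nonneg by (auto intro: less_le_trans)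
      then show ?thesis by simp
    next
      case 2
      \<comment> \<open>\<open>g_less\<close> speaks of positive levels only; level 0 is reached as
        a union of these.\<close>
      have "{x. t < g x} = (\<Union>s\<in>{0<..}. {x. s < g x})"
        using 2 dense by (fastforce intro: less_trans)
      also have "open \<dots>" by (intro open_UN ballI) (auto simp: g_less ball_vol_open)
      finally show ?thesis .
    next
      case 3 then show ?thesis by (simp add: g_less ball_vol_open)
    qed
  qed
  have mono: "g y \<le> g x" if "norm x \<le> norm y" for x y
  proof (rule dense_le)
    fix t assume t: "t < g y"
    show "t \<le> g x"
    proof (cases "0 < t")
      case True
      then have "ball_vol x < lev t" using t g_less [OF True, of y] ball_vol_mono [OF that] by auto
      then show ?thesis using g_less [OF True, of x] by auto
    next
      case False then show ?thesis using g_nonneg [of x] by linarith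
    qed
  qed
  have eq: "symm_rearr f = g"
    unfolding symm_rearr_def
  proof (rule the_equality, intro conjI allI impI)
    fix t :: real assume t: "0 < t"
    show "{x. t < g x} = set_rearr {x. t < f x}"
      using lev_fin [OF t] by (simp add: set_rearr_eq lev_def g_less [OF t])
  next
    fix h assume h: "(\<forall>x. 0 \<le> h x) \<and> (\<forall>t. open {x. t < h x}) \<and>
       (\<forall>x y. norm x \<le> norm y \<longrightarrow> h y \<le> h x) \<and> (\<forall>t>0. {x. t < h x} = set_rearr {x. t < f x})"
    show "h = g"
    proof
      fix x
      have *: "t < h x \<longleftrightarrow> t < g x" if "0 < t" for t
      proof -
        have "{x. t < h x} = {x. t < g x}"
          using h that lev_fin [OF that] by (simp add: set_rearr_eq lev_def g_less [OF that])
        then show ?thesis by auto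
      qed
      show "h x = g x"
      proof (rule ccontr)
        assume "h x \<noteq> g x"
        then consider "h x < g x" | "g x < h x" by linarith
        then show False
        proof cases
          case 1 then obtain t where "h x < t" "t < g x" using dense by blast
          then show False using * [of t] h[THEN conjunct1, THEN spec, of x] by auto
        next
          case 2 then obtain t where "g x < t" "t < h x" using dense by blast
          then show False using * [of t] g_nonneg [of x] by auto
        qed
      qed
    qed
  qed (use g_nonneg op mono in auto)
  show "0 \<le> symm_rearr f x" "0 < t \<Longrightarrow> t < symm_rearr f x \<longleftrightarrow> ball_vol x < lev t"
    "open {x. t < symm_rearr f x}"
    using g_nonneg g_less op by (auto simp: eq)
qed

lemma symm_rearr_le: "symm_rearr f x \<le> C"
proof (rule ccontr)
  assume "\<not> ?thesis"
  then obtain t where t: "C < t" "t < symm_rearr f x" using dense by (metis not_le)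
  then have "{x. t < f x} = {}" using bdd by (force simp: not_less intro: order_trans less_imp_le)
  then show False using symm_rearr_less_iff [of t x] t bdd by (auto simp: lev_def)
qed

lemma borel_measurable_symm_rearr: "symm_rearr f \<in> borel_measurable borel"
  unfolding borel_measurable_iff_greater using symm_rearr_open by auto

end

section \<open>Steiner symmetrization along lines\<close>

text \<open>Indexed by an arbitrary point \<open>x\<close> of the line instead of its foot on the
  orthogonal hyperplane, so that Fubini on the whole space applies;
  \<open>line_emeasure_shift\<close> makes the choice immaterial.\<close>

definition line_emeasure :: "'a::euclidean_space \<Rightarrow> 'a set \<Rightarrow> 'a \<Rightarrow> ennreal" where
  "line_emeasure u A x = emeasure lborel {s::real. x + s *\<^sub>R u \<in> A}"

lemma line_sets [measurable (raw)]:
  "A \<in> sets borel \<Longrightarrow> {s::real. x + s *\<^sub>R u \<in> A} \<in> sets borel" for x :: "'a::euclidean_space"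
proof -
  assume [measurable]: "A \<in> sets borel"
  have "(\<lambda>s::real. x + s *\<^sub>R u) -` A \<inter> space borel \<in> sets borel" by measurable
  then show ?thesis by (simp add: vimage_def)
qed

lemma line_emeasure_eq:
  fixes x :: "'a::euclidean_space"
  assumes [measurable]: "A \<in> sets borel"
  shows "line_emeasure u A x = (\<integral>\<^sup>+s. indicator A (x + s *\<^sub>R u) \<partial>lborel)"
proof -
  have "(\<lambda>s. indicator A (x + s *\<^sub>R u)) = (indicator {s. x + s *\<^sub>R u \<in> A} :: real \<Rightarrow> ennreal)"
    by (auto simp: indicator_def)
  then show ?thesis
    by (simp add: line_emeasure_def line_sets)
qed

lemma nn_integral_lborel_shift:
  fixes g :: "'a::euclidean_space \<Rightarrow> ennreal"
  assumes [measurable]: "g \<in> borel_measurable borel"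
  shows "(\<integral>\<^sup>+x. g (c + x) \<partial>lborel) = (\<integral>\<^sup>+x. g x \<partial>lborel)"
  by (subst (2) lborel_distr_plus [of c, symmetric]) (simp add: nn_integral_distr)

lemma nn_integral_line_shift:
  fixes g :: "'a::euclidean_space \<Rightarrow> ennreal"
  assumes [measurable]: "g \<in> borel_measurable borel"
  shows "(\<integral>\<^sup>+s. g (x + r *\<^sub>R u + s *\<^sub>R u) \<partial>lborel) = (\<integral>\<^sup>+s. g (x + s *\<^sub>R u) \<partial>lborel)"
proof -
  have "(\<integral>\<^sup>+s. g (x + r *\<^sub>R u + s *\<^sub>R u) \<partial>lborel) = (\<integral>\<^sup>+s. (\<lambda>s. g (x + s *\<^sub>R u)) (r + s) \<partial>lborel)"
    by (simp add: scaleR_add_left add_ac)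
  also have "\<dots> = (\<integral>\<^sup>+s. g (x + s *\<^sub>R u) \<partial>lborel)"
    by (rule nn_integral_lborel_shift) measurable
  finally show ?thesis .
qed

lemma line_emeasure_shift:
  fixes x :: "'a::euclidean_space"
  assumes [measurable]: "A \<in> sets borel"
  shows "line_emeasure u A (x + r *\<^sub>R u) = line_emeasure u A x"
  unfolding line_emeasure_eq [OF assms] by (rule nn_integral_line_shift) measurable

lemma borel_measurable_line_emeasure [measurable (raw)]:
  fixes A :: "'a::euclidean_space set"
  assumes [measurable]: "A \<in> sets borel" "h \<in> borel_measurable N" "v \<in> borel_measurable N"
  shows "(\<lambda>y. line_emeasure (v y) A (h y)) \<in> borel_measurable N"
  unfolding line_emeasure_eq [OF assms(1)] by measurable

lemma line_emeasure_Un: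
  fixes x :: "'a::euclidean_space"
  assumes "A \<in> sets borel" "B \<in> sets borel" "A \<inter> B = {}"
  shows "line_emeasure u (A \<union> B) x = line_emeasure u A x + line_emeasure u B x"
proof -
  have "{s::real. x + s *\<^sub>R u \<in> A \<union> B} = {s. x + s *\<^sub>R u \<in> A} \<union> {s. x + s *\<^sub>R u \<in> B}" by auto
  then show ?thesis
    unfolding line_emeasure_def using assms by (simp add: line_sets plus_emeasure disjoint_iff)
qed

text \<open>
  Slicing without an orthogonal decomposition: the slab \<open>0 \<le> x \<bullet> u \<le> 1\<close> meets every line in
  direction \<open>u\<close> in a unit segment, so integrating a function of the line over the slab amounts
  to integrating it over \<open>u\<^sup>\<bottom>\<close>; the identity itself only needs translation invariance.
\<close>

lemma nn_integral_lines:
  fixes g :: "'a::euclidean_space \<Rightarrow> ennreal"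
  assumes [measurable]: "g \<in> borel_measurable borel" and u: "norm u = 1"
  shows "(\<integral>\<^sup>+x. indicator {0..1} (x \<bullet> u) * (\<integral>\<^sup>+s. g (x + s *\<^sub>R u) \<partial>lborel) \<partial>lborel)
         = (\<integral>\<^sup>+x. g x \<partial>lborel)"
proof -
  have uu: "u \<bullet> u = 1" using u by (simp add: dot_square_norm)
  have "(\<integral>\<^sup>+x. indicator {0..1} (x \<bullet> u) * (\<integral>\<^sup>+s. g (x + s *\<^sub>R u) \<partial>lborel) \<partial>lborel)
      = (\<integral>\<^sup>+x. (\<integral>\<^sup>+s. indicator {0..1} (x \<bullet> u) * g (x + s *\<^sub>R u) \<partial>lborel) \<partial>lborel)"
    by (intro nn_integral_cong nn_integral_cmult [symmetric]) measurable
  also have "\<dots> = (\<integral>\<^sup>+s. (\<integral>\<^sup>+x. indicator {0..1} (x \<bullet> u) * g (x + s *\<^sub>R u) \<partial>lborel) \<partial>lborel)"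
    by (rule lborel_pair.Fubini') measurable
  also have "\<dots> = (\<integral>\<^sup>+s. (\<integral>\<^sup>+x. (\<lambda>x. indicator {0..1} (x \<bullet> u - s) * g x) (s *\<^sub>R u + x) \<partial>lborel) \<partial>lborel)"
    by (simp add: inner_add_left uu add_ac)
  also have "\<dots> = (\<integral>\<^sup>+s. (\<integral>\<^sup>+x. indicator {0..1} (x \<bullet> u - s) * g x \<partial>lborel) \<partial>lborel)"
    by (intro nn_integral_cong nn_integral_lborel_shift) measurable
  also have "\<dots> = (\<integral>\<^sup>+x. (\<integral>\<^sup>+s. indicator {0..1} (x \<bullet> u - s) * g x \<partial>lborel) \<partial>lborel)"
    by (rule lborel_pair.Fubini') measurable
  also have "\<dots> = (\<integral>\<^sup>+x. g x \<partial>lborel)"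
  proof (intro nn_integral_cong)
    fix x
    have "(\<integral>\<^sup>+s. indicator {0..1} (x \<bullet> u - s) * g x \<partial>lborel)
        = (\<integral>\<^sup>+s. indicator {x \<bullet> u - 1..x \<bullet> u} s * g x \<partial>lborel)"
      by (intro nn_integral_cong) (auto simp: indicator_def)
    then show "(\<integral>\<^sup>+s. indicator {0..1} (x \<bullet> u - s) * g x \<partial>lborel) = g x"
      by (simp add: nn_integral_multc)
  qed
  finally show ?thesis .
qed

lemma emeasure_lines:
  fixes A :: "'a::euclidean_space set"
  assumes [measurable]: "A \<in> sets borel" and u: "norm u = 1"
  shows "(\<integral>\<^sup>+x. indicator {0..1} (x \<bullet> u) * line_emeasure u A x \<partial>lborel) = emeasure lborel A"
  using nn_integral_lines [of "indicator A" u] u by (simp add: line_emeasure_eq)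

text \<open>A class stable under \<open>steiner\<close>. Borel measurability passes to the
  restriction to every line, and bounded support makes it vanish at infinity, so the default value 0
  in \<open>steiner\<close> is never taken.\<close>

definition admissible :: "real \<Rightarrow> real \<Rightarrow> ('a::euclidean_space \<Rightarrow> real) \<Rightarrow> bool" where
  "admissible L C g \<longleftrightarrow> g \<in> borel_measurable borel \<and> 0 \<le> L \<and> 0 \<le> C \<and>
     (\<forall>x. 0 \<le> g x \<and> g x \<le> C \<and> (L < norm x \<longrightarrow> g x = 0))"

lemma admissibleD:
  assumes "admissible L C g"
  shows "g \<in> borel_measurable borel" "0 \<le> L" "0 \<le> C" "0 \<le> g x" "g x \<le> C" "L < norm x \<Longrightarrow> g x = 0"
  using assms by (auto simp: admissible_def)

lemma sets_superlevel: "g \<in> borel_measurable borel \<Longrightarrow> {x. t < g x} \<in> sets borel"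
  for g :: "'a::topological_space \<Rightarrow> real"
  by measurable

lemma admissible_superlevel_subset:
  assumes "admissible L C g" "0 < t"
  shows "{x. t < g x} \<subseteq> cball 0 L"
  using admissibleD [OF assms(1)] assms(2) by (force simp: not_less [symmetric])

text \<open>Pythagoras: \<open>s + x \<bullet> u\<close> is the signed position on the line relative
  to its point closest to the origin.\<close>

lemma norm_line_sq:
  fixes x u :: "'a::euclidean_space"
  assumes "norm u = 1"
  shows "(norm (x + s *\<^sub>R u))\<^sup>2 = (norm (x - (x \<bullet> u) *\<^sub>R u))\<^sup>2 + (s + x \<bullet> u)\<^sup>2"
proof -
  have uu: "u \<bullet> u = 1" using assms by (simp add: dot_square_norm)
  show ?thesis
    unfolding power2_norm_eq_inner
    by (simp add: inner_add_left inner_add_right inner_diff_left inner_diff_right uu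
        inner_commute [of u x] power2_eq_square algebra_simps)
qed

text \<open>The slice lies in a chord of the ball, whose half-length is found by
  \<open>norm_line_sq\<close>; \<open>max 0\<close> covers the lines that miss the ball.\<close>

lemma line_emeasure_subset_cball_le:
  fixes x u :: "'a::euclidean_space"
  assumes u: "norm u = 1" and "A \<subseteq> cball 0 r" and "0 \<le> r"
  shows "line_emeasure u A x \<le> ennreal (2 * sqrt (max 0 (r\<^sup>2 - (norm (x - (x \<bullet> u) *\<^sub>R u))\<^sup>2)))"
proof -
  define w where "w = sqrt (max 0 (r\<^sup>2 - (norm (x - (x \<bullet> u) *\<^sub>R u))\<^sup>2))"
  have "{s. x + s *\<^sub>R u \<in> A} \<subseteq> {- (x \<bullet> u) - w .. - (x \<bullet> u) + w}"
  proof
    fix s assume "s \<in> {s. x + s *\<^sub>R u \<in> A}"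
    with assms have "norm (x + s *\<^sub>R u) \<le> r" by auto
    then have "(norm (x + s *\<^sub>R u))\<^sup>2 \<le> r\<^sup>2" by (simp add: power_mono)
    then have "(s + x \<bullet> u)\<^sup>2 \<le> max 0 (r\<^sup>2 - (norm (x - (x \<bullet> u) *\<^sub>R u))\<^sup>2)"
      unfolding norm_line_sq [OF u] by linarith
    then have "\<bar>s + x \<bullet> u\<bar> \<le> w"
      unfolding w_def using real_sqrt_le_mono by fastforce
    then show "s \<in> {- (x \<bullet> u) - w .. - (x \<bullet> u) + w}" by auto
  qed
  then have "line_emeasure u A x \<le> emeasure lborel {- (x \<bullet> u) - w .. - (x \<bullet> u) + w}"
    unfolding line_emeasure_def by (intro emeasure_mono) auto
  also have "\<dots> = ennreal (2 * w)" by (subst emeasure_lborel_Icc) (auto simp: w_def)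
  finally show ?thesis by (simp add: w_def)
qed

lemma line_emeasure_le:
  fixes x u :: "'a::euclidean_space"
  assumes u: "norm u = 1" and "A \<subseteq> cball 0 r" and "0 \<le> r"
  shows "line_emeasure u A x \<le> ennreal (2 * r)"
proof -
  have "sqrt (max 0 (r\<^sup>2 - (norm (x - (x \<bullet> u) *\<^sub>R u))\<^sup>2)) \<le> sqrt (r\<^sup>2)"
    by (intro real_sqrt_le_mono) auto
  with line_emeasure_subset_cball_le [OF assms, of x] assms(3) show ?thesis
    by (elim order_trans) (auto intro!: ennreal_leI)
qed

text \<open>The facts on \<open>symm_rearr\<close> are applied to the restriction to the line
  through \<open>x\<close>; a centered interval reaching to parameter \<open>x \<bullet> u\<close>
  has length \<open>2 * \<bar>x \<bullet> u\<bar>\<close>. \<open>steiner_less_iff\<close> replaces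
  the definition of \<open>steiner\<close> from here on.\<close>

lemma steiner_props:
  fixes u :: "'a::euclidean_space"
  assumes g: "admissible L C g" and u: "norm u = 1"
  shows steiner_nonneg: "0 \<le> steiner u g x"
    and steiner_less_iff: "0 < t \<Longrightarrow> t < steiner u g x \<longleftrightarrow>
           ennreal (2 * \<bar>x \<bullet> u\<bar>) < line_emeasure u {y. t < g y} x"
    and steiner_le: "steiner u g x \<le> C"
proof -
  note gD = admissibleD [OF g]
  have [measurable]: "g \<in> borel_measurable borel" by (rule gD)
  define \<xi> where "\<xi> = x - (x \<bullet> u) *\<^sub>R u"
  define h where "h = (\<lambda>t::real. g (\<xi> + t *\<^sub>R u))"
  have lev: "emeasure lebesgue {s. t < h s} = line_emeasure u {y. t < g y} x" for t
  proof -
    have "emeasure lebesgue {s. t < h s} = line_emeasure u {y. t < g y} \<xi>"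
      unfolding line_emeasure_def h_def using line_sets [of "{y. t < g y}" \<xi> u]
      by (simp add: sets_superlevel)
    also have "\<dots> = line_emeasure u {y. t < g y} x"
      using line_emeasure_shift [of "{y. t < g y}" u x "- (x \<bullet> u)"] by (simp add: \<xi>_def)
    finally show ?thesis .
  qed
  interpret bounded_vanishing h C
  proof
    have "h \<in> borel_measurable borel" unfolding h_def by measurable
    then show "h \<in> borel_measurable lebesgue" by (simp add: measurable_completion)
    show "vanishes_at_infinity h"
      unfolding vanishes_at_infinity_def lev
      using line_emeasure_le [OF u admissible_superlevel_subset [OF g] gD(2)]
      by (auto intro: le_less_trans [OF _ ennreal_less_top])
  qed (use gD in \<open>auto simp: h_def\<close>)
  have eq: "steiner u g x = symm_rearr h (x \<bullet> u)"
    using meas van by (simp add: steiner_def Let_def h_def \<xi>_def)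
  show "0 \<le> steiner u g x" "steiner u g x \<le> C"
    by (simp_all add: eq symm_rearr_nonneg symm_rearr_le)
  show "t < steiner u g x \<longleftrightarrow> ennreal (2 * \<bar>x \<bullet> u\<bar>) < line_emeasure u {y. t < g y} x" if "0 < t"
    using symm_rearr_less_iff [OF that, of "x \<bullet> u"]
    by (simp add: eq lev_def lev ball_vol_real)
qed

text \<open>The symmetrized slice and the chord of the ball have the same center, and the slice is
  no longer than the chord.\<close>

lemma steiner_eq_0:
  fixes u :: "'a::euclidean_space"
  assumes g: "admissible L C g" and u: "norm u = 1" and x: "L < norm x"
  shows "steiner u g x = 0"
proof (rule ccontr)
  assume "steiner u g x \<noteq> 0"
  then have "0 < steiner u g x" using steiner_nonneg [OF g u, of x] by simp
  then obtain t where t: "0 < t" "t < steiner u g x" using dense by blast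
  note L = admissibleD(2) [OF g]
  have "ennreal (2 * \<bar>x \<bullet> u\<bar>) < line_emeasure u {y. t < g y} x"
    using steiner_less_iff [OF g u t(1)] t by simp
  also have "\<dots> \<le> ennreal (2 * sqrt (max 0 (L\<^sup>2 - (norm (x - (x \<bullet> u) *\<^sub>R u))\<^sup>2)))"
    by (rule line_emeasure_subset_cball_le [OF u admissible_superlevel_subset [OF g t(1)] L])
  finally have "\<bar>x \<bullet> u\<bar> < sqrt (max 0 (L\<^sup>2 - (norm (x - (x \<bullet> u) *\<^sub>R u))\<^sup>2))"
    by (simp add: ennreal_less_iff)
  then have "sqrt ((x \<bullet> u)\<^sup>2) < sqrt (max 0 (L\<^sup>2 - (norm (x - (x \<bullet> u) *\<^sub>R u))\<^sup>2))" by simp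
  then have "(x \<bullet> u)\<^sup>2 < max 0 (L\<^sup>2 - (norm (x - (x \<bullet> u) *\<^sub>R u))\<^sup>2)"
    by (simp only: real_sqrt_less_iff)
  moreover have "0 \<le> (x \<bullet> u)\<^sup>2" by simp
  ultimately have "(norm (x - (x \<bullet> u) *\<^sub>R u))\<^sup>2 + (0 + x \<bullet> u)\<^sup>2 < L\<^sup>2" by (simp add: max_def split: if_splits)
  then have "(norm (x + 0 *\<^sub>R u))\<^sup>2 < L\<^sup>2" by (simp only: norm_line_sq [OF u])
  then have "norm x < L" using L by (auto intro: power_less_imp_less_base)
  then show False using x by simp
qed

lemma borel_measurable_iff_superlevel_pos:
  fixes h :: "'x \<Rightarrow> real"
  assumes "\<And>x. x \<in> space N \<Longrightarrow> 0 \<le> h x" and pos: "\<And>t. 0 < t \<Longrightarrow> {x \<in> space N. t < h x} \<in> sets N"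
  shows "h \<in> borel_measurable N"
  unfolding borel_measurable_iff_greater
proof
  fix t :: real
  consider "t < 0" | "t = 0" | "0 < t" by linarith
  then show "{x \<in> space N. t < h x} \<in> sets N"
  proof cases
    case 1
    then have "{x \<in> space N. t < h x} = space N" using assms(1) by (auto intro: less_le_trans)
    then show ?thesis by simp
  next
    case 2
    have "{x \<in> space N. t < h x} = (\<Union>n. {x \<in> space N. 1 / real (Suc n) < h x})"
    proof (safe, goal_cases)
      case (1 x)
      then obtain n where "1 / real (Suc n) < h x" using 2 nat_approx_posE by blast
      then show ?case using 1 by blast
    next
      case (2 x n)
      have "0 < 1 / real (Suc n)" by simp
      with 2 \<open>t = 0\<close> show ?case by linarith
    qed
    also have "\<dots> \<in> sets N" using pos by (intro sets.countable_UN) auto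
    finally show ?thesis .
  qed (use pos in auto)
qed

text \<open>Direction and function vary with a parameter, since random directions need measurability
  in parameter and point jointly. By \<open>steiner_less_iff\<close> a superlevel set compares
  \<open>2 * \<bar>x \<bullet> u\<bar>\<close> with a slice length, and the latter is an integral of
  a jointly measurable function.\<close>

lemma borel_measurable_steiner:
  fixes v :: "'p \<Rightarrow> 'a::euclidean_space" and F :: "'p \<Rightarrow> 'a \<Rightarrow> real"
  assumes [measurable]: "v \<in> borel_measurable P" "(\<lambda>(p, x). F p x) \<in> borel_measurable (P \<Otimes>\<^sub>M borel)"
    and v: "\<And>p. p \<in> space P \<Longrightarrow> norm (v p) = 1" and F: "\<And>p. p \<in> space P \<Longrightarrow> admissible L C (F p)"
  shows "(\<lambda>(p, x). steiner (v p) (F p) x) \<in> borel_measurable (P \<Otimes>\<^sub>M borel)"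
proof (rule borel_measurable_iff_superlevel_pos)
  fix z assume "z \<in> space (P \<Otimes>\<^sub>M (borel :: 'a measure))"
  then show "0 \<le> (case z of (p, x) \<Rightarrow> steiner (v p) (F p) x)"
    by (auto simp: space_pair_measure intro: steiner_nonneg [OF F v])
next
  fix t :: real assume t: "0 < t"
  have line: "line_emeasure (v p) {y. t < F p y} x
      = (\<integral>\<^sup>+s. indicator {t<..} (F p (x + s *\<^sub>R v p)) \<partial>lborel)" if "p \<in> space P" for p x
    using admissibleD(1) [OF F [OF that]]
    by (subst line_emeasure_eq) (auto simp: sets_superlevel indicator_def intro!: nn_integral_cong)
  have "{z \<in> space (P \<Otimes>\<^sub>M borel). t < (case z of (p, x) \<Rightarrow> steiner (v p) (F p) x)}
      = {z \<in> space (P \<Otimes>\<^sub>M borel). ennreal (2 * \<bar>snd z \<bullet> v (fst z)\<bar>)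
          < (\<integral>\<^sup>+s. indicator {t<..} ((\<lambda>(p, x). F p x) (fst z, snd z + s *\<^sub>R v (fst z))) \<partial>lborel)}"
    by (auto simp: space_pair_measure steiner_less_iff [OF F v t] line)
  also have "\<dots> \<in> sets (P \<Otimes>\<^sub>M borel)" by measurable
  finally show "{z \<in> space (P \<Otimes>\<^sub>M borel). t < (case z of (p, x) \<Rightarrow> steiner (v p) (F p) x)}
    \<in> sets (P \<Otimes>\<^sub>M borel)" .
qed

lemma admissible_steiner:
  fixes u :: "'a::euclidean_space"
  assumes g: "admissible L C g" and u: "norm u = 1"
  shows "admissible L C (steiner u g)"
proof -
  have [measurable]: "g \<in> borel_measurable borel" by (rule admissibleD [OF g])
  have "(\<lambda>(p, x). steiner u g x) \<in> borel_measurable (count_space {()} \<Otimes>\<^sub>M borel)"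
    by (rule borel_measurable_steiner [OF _ _ u g]) measurable
  then have "(\<lambda>x. (\<lambda>(p, x). steiner u g x) ((), x)) \<in> borel_measurable borel"
    by measurable
  then show ?thesis
    using steiner_nonneg [OF g u] steiner_le [OF g u] steiner_eq_0 [OF g u] admissibleD [OF g]
    by (simp add: admissible_def)
qed

section \<open>Decrease of the symmetric difference\<close>

text \<open>By \<open>steiner_less_iff\<close> the new slice is the open interval of the old length
  \<open>l\<close> about the parameter \<open>- (x \<bullet> u)\<close>.\<close>

lemma line_emeasure_steiner_superlevel:
  fixes u x :: "'a::euclidean_space"
  assumes g: "admissible L C g" and u: "norm u = 1" and t: "0 < t"
  shows "line_emeasure u {y. t < steiner u g y} x = line_emeasure u {y. t < g y} x"
proof -
  define A where "A = {y. t < g y}"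
  have A: "A \<in> sets borel" unfolding A_def using admissibleD(1) [OF g] by (rule sets_superlevel)
  have uu: "u \<bullet> u = 1" using u by (simp add: dot_square_norm)
  have "line_emeasure u A x \<le> ennreal (2 * L)"
    unfolding A_def
    using line_emeasure_le [OF u admissible_superlevel_subset [OF g t] admissibleD(2) [OF g]] .
  then obtain l where l: "line_emeasure u A x = ennreal l" "0 \<le> l"
    by (metis ennreal_cases ennreal_neq_top top.extremum_unique)
  have "{s::real. x + s *\<^sub>R u \<in> {y. t < steiner u g y}} = {- (x \<bullet> u) - l / 2 <..< - (x \<bullet> u) + l / 2}"
  proof (intro set_eqI)
    fix s :: real
    have "s \<in> {s. x + s *\<^sub>R u \<in> {y. t < steiner u g y}} \<longleftrightarrow> ennreal (2 * \<bar>(x + s *\<^sub>R u) \<bullet> u\<bar>) < ennreal l"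
      using steiner_less_iff [OF g u t, of "x + s *\<^sub>R u"]
      by (simp add: A_def [symmetric] line_emeasure_shift [OF A] l(1))
    also have "\<dots> \<longleftrightarrow> 2 * \<bar>x \<bullet> u + s\<bar> < l"
      by (simp add: ennreal_less_iff inner_add_left uu)
    also have "\<dots> \<longleftrightarrow> s \<in> {- (x \<bullet> u) - l / 2 <..< - (x \<bullet> u) + l / 2}"
      using abs_less_iff [of "x \<bullet> u + s" "l / 2"] by auto
    finally show "s \<in> {s. x + s *\<^sub>R u \<in> {y. t < steiner u g y}} \<longleftrightarrow>
      s \<in> {- (x \<bullet> u) - l / 2 <..< - (x \<bullet> u) + l / 2}" .
  qed
  then have "line_emeasure u {y. t < steiner u g y} x = ennreal l"
    unfolding line_emeasure_def using l(2) by simp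
  then show ?thesis using l(1) by (simp add: A_def)
qed

lemma emeasure_steiner_superlevel:
  fixes u :: "'a::euclidean_space"
  assumes g: "admissible L C g" and u: "norm u = 1" and t: "0 < t"
  shows "emeasure lborel {y. t < steiner u g y} = emeasure lborel {y. t < g y}"
  using emeasure_lines [OF sets_superlevel [OF admissibleD(1) [OF admissible_steiner [OF g u]]] u, of t]
    emeasure_lines [OF sets_superlevel [OF admissibleD(1) [OF g]] u, of t]
  by (simp add: line_emeasure_steiner_superlevel [OF g u t])

lemma admissible_bounded_vanishing:
  fixes g :: "'a::euclidean_space \<Rightarrow> real"
  assumes g: "admissible L C g"
  shows "bounded_vanishing g C"
proof
  have "emeasure lebesgue {x. t < g x} < \<infinity>" if "0 < t" for t
  proof -
    have "emeasure lebesgue {x. t < g x} \<le> emeasure lebesgue (cball (0::'a) L)"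
      by (intro emeasure_mono admissible_superlevel_subset [OF g that]) auto
    also have "\<dots> < \<infinity>" by (simp add: emeasure_cball admissibleD(2) [OF g])
    finally show ?thesis .
  qed
  then show "vanishes_at_infinity g" by (simp add: vanishes_at_infinity_def)
qed (use admissibleD [OF g] in \<open>auto intro: measurable_completion\<close>)

lemma symm_rearr_superlevel:
  fixes g :: "'a::euclidean_space \<Rightarrow> real"
  assumes g: "admissible L C g" and t: "0 < t"
  obtains r where "0 \<le> r" "r \<le> L" "{x. t < symm_rearr g x} = ball 0 r"
    "emeasure lborel (ball (0::'a) r) = emeasure lborel {x. t < g x}"
proof -
  interpret bounded_vanishing g C by (rule admissible_bounded_vanishing [OF g])
  have lev: "lev t = emeasure lborel {x. t < g x}"
    using sets_superlevel [OF admissibleD(1) [OF g]] by (simp add: lev_def)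
  obtain r where r: "0 \<le> r" "emeasure lborel (ball (0::'a) r) = lev t"
    using ex_ball_emeasure_eq [OF lev_fin [OF t]] by metis
  have eq: "{x. t < symm_rearr g x} = ball 0 r"
    unfolding symm_rearr_less_iff [OF t] r(2) [symmetric] ball_vol_less_iff [OF r(1)] by auto
  have "r \<le> L"
  proof (rule ccontr)
    assume "\<not> r \<le> L"
    \<comment> \<open>A unit vector, to have a point of norm \<open>L\<close> at which volumes can
      be compared.\<close>
    obtain b :: 'a where b: "b \<in> Basis" using nonempty_Basis by blast
    have L: "0 \<le> L" by (rule admissibleD [OF g])
    have "lev t \<le> emeasure lborel (cball (0::'a) L)"
      unfolding lev by (intro emeasure_mono admissible_superlevel_subset [OF g t]) auto
    also have "\<dots> = ball_vol (L *\<^sub>R b)"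
      using b L by (simp add: ball_vol_eq emeasure_cball)
    also have "\<dots> < emeasure lborel (ball (0::'a) r)"
      using \<open>\<not> r \<le> L\<close> b L by (subst ball_vol_less_iff [OF r(1)]) simp
    finally show False using r(2) by simp
  qed
  then show ?thesis using that r eq lev by simp
qed

text \<open>Here \<open>c\<close> is the length of the overlap and primes refer to the symmetrized
  set. The difference \<open>a - b\<close> is preserved, and as one of \<open>a'\<close> and
  \<open>b'\<close> vanishes, the new sum is \<open>a + b - 2 min(a, b)\<close>. Finally
  \<open>a b <= 2 L min(a, b)\<close>.\<close>

lemma steiner_defect_line:
  fixes a b c a' b' c' L :: real
  assumes "0 \<le> a" "0 \<le> b" "0 \<le> c" "0 \<le> a'" "0 \<le> b'" "0 \<le> c'" "a \<le> 2 * L" "b \<le> 2 * L" "0 < L"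
    and "a' + c' = a + c" "b' + c' = b + c" "a' = 0 \<or> b' = 0"
  shows "a' + b' + 1 / L * (a * b) \<le> a + b"
proof -
  have "a * b \<le> a * (2 * L)" "a * b \<le> (2 * L) * b"
    using assms by (auto intro: mult_left_mono mult_right_mono)
  then have *: "1 / L * (a * b) \<le> 2 * a" "1 / L * (a * b) \<le> 2 * b"
    using \<open>0 < L\<close> by (auto simp: field_simps)
  show ?thesis
  proof (cases "a' = 0")
    case True
    then have "b' = b - a" using assms by linarith
    then show ?thesis using * True by linarith
  next
    case False
    then have "b' = 0" "a' = a - b" using assms by linarith+
    then show ?thesis using * by linarith
  qed
qed

lemma steiner_defect_step:
  fixes u :: "'a::euclidean_space" and g :: "'a \<Rightarrow> real"
  assumes g: "admissible L C g" and L: "0 < L" and u: "norm u = 1" and t: "0 < t" and r: "r \<le> L"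
  defines "A \<equiv> {y. t < g y}" and "A' \<equiv> {y. t < steiner u g y}" and "B \<equiv> ball 0 r"
  shows "emeasure lborel (sym_diff A' B) +
           ennreal (1 / L) * (\<integral>\<^sup>+x. indicator (B - A) x * line_emeasure u (A - B) x \<partial>lborel)
         \<le> emeasure lborel (sym_diff A B)"
proof -
  have [measurable]: "A \<in> sets borel" "A' \<in> sets borel" "B \<in> sets borel"
    using admissibleD(1) [OF g] admissibleD(1) [OF admissible_steiner [OF g u]]
    by (auto simp: A_def A'_def B_def sets_superlevel)
  have uu: "u \<bullet> u = 1" using u by (simp add: dot_square_norm)
  have sub: "A \<subseteq> cball 0 L" "A' \<subseteq> cball 0 L" "B \<subseteq> cball 0 L"
    using admissible_superlevel_subset [OF g t] admissible_superlevel_subset [OF admissible_steiner [OF g u] t] r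
    by (auto simp: A_def A'_def B_def)
  have fin: "\<exists>l\<ge>0. line_emeasure u X x = ennreal l \<and> l \<le> 2 * L" if "X \<subseteq> cball 0 L" for X x
    using line_emeasure_le [OF u that, of x] L
    by (cases "line_emeasure u X x") (auto simp: top_unique)
  \<comment> \<open>A point of \<open>B - A'\<close> and a point of \<open>A' - B\<close> on the
    same line are incompatible: the former is farther from the center of the slice, hence by
    \<open>norm_line_sq\<close> farther from the origin, although it lies in the ball and the latter
    does not.\<close>
  have nested: "line_emeasure u (B - A') x = 0 \<or> line_emeasure u (A' - B) x = 0" for x
  proof -
    have "{s. x + s *\<^sub>R u \<in> B - A'} = {} \<or> {s. x + s *\<^sub>R u \<in> A' - B} = {}"
    proof (rule ccontr)
      assume "\<not> ?thesis"
      then obtain s s' where s: "x + s *\<^sub>R u \<in> B" "x + s *\<^sub>R u \<notin> A'"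
        and s': "x + s' *\<^sub>R u \<in> A'" "x + s' *\<^sub>R u \<notin> B" by auto
      have "ennreal (2 * \<bar>x \<bullet> u + s'\<bar>) < line_emeasure u A x"
        "\<not> ennreal (2 * \<bar>x \<bullet> u + s\<bar>) < line_emeasure u A x"
        using s(2) s'(1) steiner_less_iff [OF g u t, of "x + s *\<^sub>R u"]
          steiner_less_iff [OF g u t, of "x + s' *\<^sub>R u"]
        by (simp_all add: A'_def A_def [symmetric] line_emeasure_shift inner_add_left uu)
      then have "ennreal (2 * \<bar>x \<bullet> u + s'\<bar>) < ennreal (2 * \<bar>x \<bullet> u + s\<bar>)" by simp
      then have "\<bar>s' + x \<bullet> u\<bar> < \<bar>s + x \<bullet> u\<bar>" by (simp add: ennreal_less_iff add.commute)
      then have "(s' + x \<bullet> u)\<^sup>2 < (s + x \<bullet> u)\<^sup>2" by (metis abs_ge_zero power2_abs power_strict_mono zero_less_numeral)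
      then have "(norm (x + s' *\<^sub>R u))\<^sup>2 < (norm (x + s *\<^sub>R u))\<^sup>2" by (simp add: norm_line_sq [OF u])
      then have "norm (x + s' *\<^sub>R u) < norm (x + s *\<^sub>R u)" by (rule power_less_imp_less_base) simp
      then show False using s(1) s'(2) by (auto simp: B_def)
    qed
    then show ?thesis
      unfolding line_emeasure_def by (elim disjE) (simp_all only: emeasure_empty simp_thms)
  qed
  have line: "line_emeasure u (sym_diff A' B) x +
      ennreal (1 / L) * (line_emeasure u (B - A) x * line_emeasure u (A - B) x)
      \<le> line_emeasure u (sym_diff A B) x" for x
  proof -
    obtain a where a: "0 \<le> a" "line_emeasure u (B - A) x = ennreal a" "a \<le> 2 * L"
      using fin [of "B - A" x] sub by blast
    obtain b where b: "0 \<le> b" "line_emeasure u (A - B) x = ennreal b" "b \<le> 2 * L"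
      using fin [of "A - B" x] sub by blast
    obtain c where c: "0 \<le> c" "line_emeasure u (A \<inter> B) x = ennreal c"
      using fin [of "A \<inter> B" x] sub by blast
    obtain a' where a': "0 \<le> a'" "line_emeasure u (B - A') x = ennreal a'"
      using fin [of "B - A'" x] sub by blast
    obtain b' where b': "0 \<le> b'" "line_emeasure u (A' - B) x = ennreal b'"
      using fin [of "A' - B" x] sub by blast
    obtain c' where c': "0 \<le> c'" "line_emeasure u (A' \<inter> B) x = ennreal c'"
      using fin [of "A' \<inter> B" x] sub by blast
    have split: "line_emeasure u X x = line_emeasure u (X - Y) x + line_emeasure u (X \<inter> Y) x"
      if [measurable]: "X \<in> sets borel" "Y \<in> sets borel" for X Y
    proof -
      have "(X - Y) \<union> (X \<inter> Y) = X" "(X - Y) \<inter> (X \<inter> Y) = {}" by auto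
      then show ?thesis using line_emeasure_Un [of "X - Y" "X \<inter> Y" u x] by simp
    qed
    have "line_emeasure u A' x = line_emeasure u A x"
      using line_emeasure_steiner_superlevel [OF g u t] by (simp add: A_def A'_def)
    then have "ennreal b' + ennreal c' = ennreal b + ennreal c"
      using split [of A B] split [of A' B] b b' c c' by simp
    moreover have "ennreal a' + ennreal c' = ennreal a + ennreal c"
      using split [of B A] split [of B A'] a a' c c' by (simp add: Int_commute)
    moreover have "a' = 0 \<or> b' = 0" using nested [of x] a' b' by auto
    ultimately have "a' + b' + 1 / L * (a * b) \<le> a + b"
      using a b c a' b' c' L
      by (intro steiner_defect_line [where c = c and c' = c']) (auto simp flip: ennreal_plus)
    then have "ennreal (a' + b' + 1 / L * (a * b)) \<le> ennreal (a + b)" by (rule ennreal_leI)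
    moreover have "ennreal (a' + b' + k * (a * b)) = ennreal b' + ennreal a' + ennreal k * (ennreal a * ennreal b)"
      if "0 \<le> k" for k
      using a b a' b' that by (simp add: ennreal_mult add.commute)
    ultimately have "ennreal b' + ennreal a' + ennreal (1 / L) * (ennreal a * ennreal b) \<le> ennreal b + ennreal a"
      using a b L by (metis add.commute ennreal_plus less_imp_le zero_less_divide_1_iff)
    then show ?thesis
      using a b a' b' by (subst (1 2) line_emeasure_Un) auto
  qed
  \<comment> \<open>The slice length of \<open>A - B\<close> is constant along each line, so it
    leaves the line integral and the product \<open>a b\<close> of slice lengths appears.\<close>
  have "(\<integral>\<^sup>+x. indicator (B - A) x * line_emeasure u (A - B) x \<partial>lborel)
      = (\<integral>\<^sup>+x. indicator {0..1} (x \<bullet> u) *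
          (\<integral>\<^sup>+s. indicator (B - A) (x + s *\<^sub>R u) * line_emeasure u (A - B) (x + s *\<^sub>R u) \<partial>lborel) \<partial>lborel)"
    by (rule nn_integral_lines [OF _ u, symmetric]) measurable
  also have "\<dots> = (\<integral>\<^sup>+x. indicator {0..1} (x \<bullet> u) *
      (line_emeasure u (B - A) x * line_emeasure u (A - B) x) \<partial>lborel)"
    by (intro nn_integral_cong) (simp add: line_emeasure_shift nn_integral_multc line_emeasure_eq [of "B - A"])
  finally have "emeasure lborel (sym_diff A' B) +
      ennreal (1 / L) * (\<integral>\<^sup>+x. indicator (B - A) x * line_emeasure u (A - B) x \<partial>lborel)
    = (\<integral>\<^sup>+x. indicator {0..1} (x \<bullet> u) * line_emeasure u (sym_diff A' B) x \<partial>lborel) +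
      ennreal (1 / L) * (\<integral>\<^sup>+x. indicator {0..1} (x \<bullet> u) *
        (line_emeasure u (B - A) x * line_emeasure u (A - B) x) \<partial>lborel)"
    by (simp add: emeasure_lines [OF _ u])
  also have "\<dots> = (\<integral>\<^sup>+x. indicator {0..1} (x \<bullet> u) * (line_emeasure u (sym_diff A' B) x +
      ennreal (1 / L) * (line_emeasure u (B - A) x * line_emeasure u (A - B) x)) \<partial>lborel)"
    by (simp add: nn_integral_add nn_integral_cmult [symmetric] distrib_left mult_ac)
  also have "\<dots> \<le> (\<integral>\<^sup>+x. indicator {0..1} (x \<bullet> u) * line_emeasure u (sym_diff A B) x \<partial>lborel)"
    by (intro nn_integral_mono mult_left_mono line) simp
  also have "\<dots> = emeasure lborel (sym_diff A B)"
    by (rule emeasure_lines [OF _ u]) measurable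
  finally show ?thesis .
qed

section \<open>Averaging over the sphere\<close>

lemma borel_measurable_sgn_vector [measurable (raw)]:
  fixes h :: "'x \<Rightarrow> 'a::euclidean_space"
  assumes [measurable]: "h \<in> borel_measurable N"
  shows "(\<lambda>x. sgn (h x)) \<in> borel_measurable N"
  unfolding sgn_div_norm by measurable

lemma sets_uniform_sphere [measurable_cong]:
  "sets (uniform_sphere :: 'a::euclidean_space measure) = sets (restrict_space borel (sphere 0 1))"
  unfolding uniform_sphere_def by (intro sets_restrict_space_cong) simp

lemma space_uniform_sphere: "space (uniform_sphere :: 'a::euclidean_space measure) = sphere 0 1"
  by (simp add: uniform_sphere_def space_restrict_space)

lemma borel_measurable_uniform_sphere:
  "h \<in> borel_measurable borel \<Longrightarrow> h \<in> borel_measurable (uniform_sphere :: 'a::euclidean_space measure)"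
  by (simp add: measurable_cong_sets [OF sets_uniform_sphere refl] measurable_restrict_space1)

text \<open>The sphere is sampled by projecting the solid ball radially; the origin is removed
  because \<open>sgn 0\<close> is not on the sphere.\<close>

lemma nn_integral_uniform_sphere:
  fixes h :: "'a::euclidean_space \<Rightarrow> ennreal"
  assumes [measurable]: "h \<in> borel_measurable borel"
  shows "(\<integral>\<^sup>+u. h u \<partial>uniform_sphere) =
    (\<integral>\<^sup>+z. h (sgn z) * indicator (ball 0 1 - {0}) z \<partial>lborel) / ennreal (unit_ball_vol (real DIM('a)))"
proof -
  have [measurable]: "(sgn :: 'a \<Rightarrow> 'a) \<in> borel_measurable borel" by measurable
  have [measurable]: "sphere (0::'a) 1 \<in> sets borel" "ball (0::'a) 1 \<in> sets borel" by auto
  have "(\<integral>\<^sup>+u. h u \<partial>uniform_sphere) =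
      (\<integral>\<^sup>+u. h u * indicator (sphere 0 1) u \<partial>distr (uniform_measure lborel (ball 0 1)) borel sgn)"
    unfolding uniform_sphere_def by (subst nn_integral_restrict_space) auto
  also have "\<dots> = (\<integral>\<^sup>+z. h (sgn z) * indicator (sphere 0 1) (sgn z) \<partial>uniform_measure lborel (ball 0 1))"
    by (rule nn_integral_distr) measurable
  also have "\<dots> = (\<integral>\<^sup>+z. h (sgn z) * indicator (sphere 0 1) (sgn z) * indicator (ball 0 1) z
      \<partial>lborel) / emeasure lborel (ball (0::'a) 1)"
    by (rule nn_integral_uniform_measure) measurable
  also have "(\<lambda>z::'a. h (sgn z) * indicator (sphere 0 1) (sgn z) * indicator (ball 0 1) z) =
      (\<lambda>z. h (sgn z) * indicator (ball 0 1 - {0}) z)"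
    by (auto simp: indicator_def norm_sgn fun_eq_iff)
  finally show ?thesis by (simp add: emeasure_ball)
qed

lemma prob_space_uniform_sphere: "prob_space (uniform_sphere :: 'a::euclidean_space measure)"
proof
  have "emeasure (uniform_sphere :: 'a measure) (space uniform_sphere) = (\<integral>\<^sup>+u. 1 \<partial>(uniform_sphere :: 'a measure))"
    by simp
  also have "\<dots> = emeasure lborel (ball (0::'a) 1 - {0}) / ennreal (unit_ball_vol (real DIM('a)))"
    by (subst nn_integral_uniform_sphere) auto
  also have "emeasure lborel (ball (0::'a) 1 - {0}) = emeasure lborel (ball (0::'a) 1)"
    by (subst emeasure_Diff_null_set) (auto simp: null_sets_def)
  finally show "emeasure (uniform_sphere :: 'a measure) (space uniform_sphere) = 1"
    using unit_ball_vol_pos [of "real DIM('a)"]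
    by (simp add: emeasure_ball divide_ennreal less_imp_neq [symmetric] del: unit_ball_vol_pos)
qed

text \<open>The integral over the dilation factor that remains in the polar coordinate formula for
  fixed \<open>y\<close>, with \<open>r = norm y\<close>. Each half-line contributes
  \<open>1 / (d r^d)\<close>.\<close>

lemma nn_integral_inverse_power_tail:
  fixes r :: real
  assumes r: "0 < r" and d: "0 < d"
  shows "(\<integral>\<^sup>+\<tau>. ennreal (1 / \<bar>\<tau>\<bar> ^ Suc d) * indicator {\<tau>. r < \<bar>\<tau>\<bar>} \<tau> \<partial>lborel) = ennreal (2 / (real d * r ^ d))"
proof -
  let ?f = "\<lambda>\<tau>::real. if r \<le> \<tau> then 1 / \<tau> ^ Suc d else 0"
  have half: "(\<integral>\<^sup>+\<tau>. ennreal (?f \<tau>) * indicator {r..} \<tau> \<partial>lborel) = ennreal (0 - (- 1 / (real d * r ^ d)))"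
  proof (rule nn_integral_FTC_atLeast)
    fix x assume x: "r \<le> x"
    have "((\<lambda>x. - 1 / (real d * x ^ d)) has_real_derivative 1 / x ^ Suc d) (at x)"
    proof -
      obtain k where k: "d = Suc k" using d by (metis Suc_pred)
      have "x \<noteq> 0" using x r by simp
      then have "((\<lambda>x. inverse (x ^ d)) has_real_derivative - (inverse (x ^ d) * (real d * x ^ k) * inverse (x ^ d))) (at x)"
        unfolding k using DERIV_pow [of "Suc k" x UNIV] by (intro DERIV_inverse') (auto simp del: power_Suc)
      from DERIV_cmult [OF this, of "- (1 / real d)"]
      have "((\<lambda>x. - (1 / real d) * inverse (x ^ d)) has_real_derivative 1 / x ^ Suc d) (at x)"
        using d \<open>x \<noteq> 0\<close> by (simp add: k divide_simps del: of_nat_Suc)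
      then show ?thesis by (simp add: divide_inverse)
    qed
    then show "((\<lambda>x. - 1 / (real d * x ^ d)) has_real_derivative ?f x) (at x)" using x by simp
  next
    have "filterlim (\<lambda>x::real. real d * x ^ d) at_top at_top"
      using d by (intro filterlim_tendsto_pos_mult_at_top [OF tendsto_const] filterlim_pow_at_top filterlim_ident) auto
    then show "((\<lambda>x::real. - 1 / (real d * x ^ d)) \<longlongrightarrow> 0) at_top"
      by (rule real_tendsto_divide_at_top [OF tendsto_const])
  qed (use r in auto)
  let ?g = "\<lambda>\<tau>::real. ennreal (1 / \<bar>\<tau>\<bar> ^ Suc d) * indicator {r<..} \<tau>"
  have pos: "(\<integral>\<^sup>+\<tau>. ?g \<tau> \<partial>lborel) = ennreal (1 / (real d * r ^ d))"
  proof -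
    have "(\<integral>\<^sup>+\<tau>. ?g \<tau> \<partial>lborel) = (\<integral>\<^sup>+\<tau>. ennreal (?f \<tau>) * indicator {r..} \<tau> \<partial>lborel)"
      using AE_lborel_singleton [of r] r
      by (intro nn_integral_cong_AE) (auto elim!: eventually_mono simp: indicator_def)
    then show ?thesis using half by simp
  qed
  have "(\<integral>\<^sup>+\<tau>. ?g (- \<tau>) \<partial>lborel) = ennreal (1 / (real d * r ^ d))"
    using nn_integral_real_affine [of ?g "-1" 0] pos by simp
  moreover have "(\<integral>\<^sup>+\<tau>. ennreal (1 / \<bar>\<tau>\<bar> ^ Suc d) * indicator {\<tau>. r < \<bar>\<tau>\<bar>} \<tau> \<partial>lborel) =
      (\<integral>\<^sup>+\<tau>. ?g \<tau> + ?g (- \<tau>) \<partial>lborel)"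
    using r by (intro nn_integral_cong) (auto simp: indicator_def)
  moreover have "\<dots> = (\<integral>\<^sup>+\<tau>. ?g \<tau> \<partial>lborel) + (\<integral>\<^sup>+\<tau>. ?g (- \<tau>) \<partial>lborel)"
    by (rule nn_integral_add) measurable
  ultimately show ?thesis
    using pos r by (simp add: ennreal_plus [symmetric] add_divide_distrib [symmetric] del: ennreal_plus)
qed

text \<open>The substitution \<open>y = \<tau> z\<close>: the Jacobian gives the power
  \<open>d\<close> of \<open>1 / \<bar>\<tau>\<bar>\<close>, the factor \<open>norm z\<close> one
  more, and the unit ball becomes the condition \<open>norm y < \<bar>\<tau>\<bar>\<close>.\<close>

lemma nn_integral_scaled_ball:
  fixes G :: "'a::euclidean_space \<Rightarrow> ennreal"
  assumes [measurable]: "G \<in> borel_measurable borel" and \<tau>: "\<tau> \<noteq> 0"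
  shows "(\<integral>\<^sup>+z. ennreal (norm z) * G (\<tau> *\<^sub>R z) * indicator (ball 0 1 - {0}) z \<partial>lborel)
    = (\<integral>\<^sup>+y. G y * ennreal (norm y) * indicator (- {0}) y *
         (ennreal (1 / \<bar>\<tau>\<bar> ^ Suc DIM('a)) * indicator {\<tau>. norm y < \<bar>\<tau>\<bar>} \<tau>) \<partial>lborel)" (is "?l = ?r")
proof -
  let ?h = "\<lambda>y. G y * ennreal (norm y) * indicator (- {0}) y *
    (ennreal (1 / \<bar>\<tau>\<bar> ^ Suc DIM('a)) * indicator {\<tau>. norm y < \<bar>\<tau>\<bar>} \<tau>)"
  have "?r = (\<integral>\<^sup>+z. ennreal (\<bar>\<tau>\<bar> ^ DIM('a)) * ?h (\<tau> *\<^sub>R z) \<partial>lborel)"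
    using \<tau> by (subst lborel_affine [OF \<tau>, of 0]) (simp add: nn_integral_density nn_integral_distr)
  also have "\<dots> = ?l"
  proof (intro nn_integral_cong)
    fix z :: 'a
    show "ennreal (\<bar>\<tau>\<bar> ^ DIM('a)) * ?h (\<tau> *\<^sub>R z) =
        ennreal (norm z) * G (\<tau> *\<^sub>R z) * indicator (ball 0 1 - {0}) z"
    proof (cases "z \<in> ball 0 1 - {0}")
      case True
      have "ennreal (\<bar>\<tau>\<bar> ^ DIM('a)) * ennreal (norm (\<tau> *\<^sub>R z)) * ennreal (1 / \<bar>\<tau>\<bar> ^ Suc DIM('a))
        = ennreal (norm z)"
        using \<tau> by (simp add: ennreal_mult [symmetric])
      then show ?thesis using True \<tau>
        by (simp add: indicator_def mult_ac)
    next
      case False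
      then show ?thesis using \<tau> by (auto simp: indicator_def)
    qed
  qed
  finally show ?thesis ..
qed

text \<open>Polar coordinates, obtained from the solid definition of the uniform distribution.\<close>

lemma nn_integral_uniform_sphere_lines:
  fixes G :: "'a::euclidean_space \<Rightarrow> ennreal"
  assumes [measurable]: "G \<in> borel_measurable borel"
  shows "(\<integral>\<^sup>+u. (\<integral>\<^sup>+s. G (s *\<^sub>R u) \<partial>lborel) \<partial>uniform_sphere) =
    (\<integral>\<^sup>+y. G y * indicator (- {0}) y * ennreal (norm y) * ennreal (2 / (real DIM('a) * norm y ^ DIM('a))) \<partial>lborel)
      / ennreal (unit_ball_vol (real DIM('a)))"
proof -
  have [measurable]: "ball (0::'a) 1 \<in> sets borel" "{0::'a} \<in> sets borel" by auto
  let ?I = "indicator (ball 0 1 - {0}) :: 'a \<Rightarrow> ennreal"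
  \<comment> \<open>Substituting \<open>s = norm z * \<tau>\<close> replaces the unit vector
    \<open>sgn z\<close> by \<open>z\<close> itself at the price of a factor
    \<open>norm z\<close>.\<close>
  have "(\<integral>\<^sup>+z. (\<integral>\<^sup>+s. G (s *\<^sub>R sgn z) \<partial>lborel) * ?I z \<partial>lborel) =
     (\<integral>\<^sup>+z. (\<integral>\<^sup>+\<tau>. ennreal (norm z) * G (\<tau> *\<^sub>R z) * ?I z \<partial>lborel) \<partial>lborel)"
  proof (intro nn_integral_cong)
    fix z :: 'a
    show "(\<integral>\<^sup>+s. G (s *\<^sub>R sgn z) \<partial>lborel) * ?I z = (\<integral>\<^sup>+\<tau>. ennreal (norm z) * G (\<tau> *\<^sub>R z) * ?I z \<partial>lborel)"
    proof (cases "z = 0")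
      case False
      then have "(\<integral>\<^sup>+s. G (s *\<^sub>R sgn z) \<partial>lborel) =
          ennreal (norm z) * (\<integral>\<^sup>+\<tau>. G ((norm z * \<tau>) *\<^sub>R sgn z) \<partial>lborel)"
        using nn_integral_real_affine [of "\<lambda>s. G (s *\<^sub>R sgn z)" "norm z" 0]
        by simp
      moreover have "(norm z * s) *\<^sub>R sgn z = s *\<^sub>R z" for s
        using False by (simp add: sgn_div_norm)
      ultimately have "(\<integral>\<^sup>+s. G (s *\<^sub>R sgn z) \<partial>lborel) = ennreal (norm z) * (\<integral>\<^sup>+\<tau>. G (\<tau> *\<^sub>R z) \<partial>lborel)"
        by simp
      then show ?thesis by (simp add: nn_integral_cmult nn_integral_multc)
    qed simp
  qed
  also have "\<dots> = (\<integral>\<^sup>+\<tau>. (\<integral>\<^sup>+z. ennreal (norm z) * G (\<tau> *\<^sub>R z) * ?I z \<partial>lborel) \<partial>lborel)"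
    by (rule lborel_pair.Fubini') measurable
  also have "\<dots> = (\<integral>\<^sup>+\<tau>. (\<integral>\<^sup>+y. G y * ennreal (norm y) * indicator (- {0}) y *
         (ennreal (1 / \<bar>\<tau>\<bar> ^ Suc DIM('a)) * indicator {\<tau>. norm y < \<bar>\<tau>\<bar>} \<tau>) \<partial>lborel) \<partial>lborel)"
    by (intro nn_integral_cong_AE eventually_mono [OF AE_lborel_singleton [of "0::real"]]
        nn_integral_scaled_ball assms)
  also have "\<dots> = (\<integral>\<^sup>+y. (\<integral>\<^sup>+\<tau>. G y * ennreal (norm y) * indicator (- {0}) y *
         (ennreal (1 / \<bar>\<tau>\<bar> ^ Suc DIM('a)) * indicator {\<tau>. norm y < \<bar>\<tau>\<bar>} \<tau>) \<partial>lborel) \<partial>lborel)"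
    by (rule lborel_pair.Fubini') (simp only: indicator_def mem_Collect_eq, measurable)
  also have "\<dots> = (\<integral>\<^sup>+y. G y * indicator (- {0}) y * ennreal (norm y) *
      ennreal (2 / (real DIM('a) * norm y ^ DIM('a))) \<partial>lborel)"
  proof (intro nn_integral_cong)
    fix y :: 'a
    show "(\<integral>\<^sup>+\<tau>. G y * ennreal (norm y) * indicator (- {0}) y *
         (ennreal (1 / \<bar>\<tau>\<bar> ^ Suc DIM('a)) * indicator {\<tau>. norm y < \<bar>\<tau>\<bar>} \<tau>) \<partial>lborel) =
       G y * indicator (- {0}) y * ennreal (norm y) * ennreal (2 / (real DIM('a) * norm y ^ DIM('a)))"
      using nn_integral_inverse_power_tail [of "norm y" "DIM('a)"]
      by (cases "y = 0") (simp_all add: nn_integral_cmult mult_ac)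
  qed
  finally show ?thesis
    by (subst nn_integral_uniform_sphere) simp_all
qed

text \<open>The density \<open>2 / (d v |y|^(d-1))\<close> is nonincreasing in
  \<open>norm y\<close>, so on the ball of radius \<open>R\<close> it is bounded below by its value
  at \<open>R\<close>.\<close>

lemma nn_integral_uniform_sphere_lines_ge:
  fixes G :: "'a::euclidean_space \<Rightarrow> ennreal"
  assumes [measurable]: "G \<in> borel_measurable borel" and R: "0 < R" and G: "\<And>y. R < norm y \<Longrightarrow> G y = 0"
  shows "ennreal (2 * R / (real DIM('a) * (unit_ball_vol (real DIM('a)) * R ^ DIM('a)))) * (\<integral>\<^sup>+y. G y \<partial>lborel)
    \<le> (\<integral>\<^sup>+u. (\<integral>\<^sup>+s. G (s *\<^sub>R u) \<partial>lborel) \<partial>uniform_sphere)"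
proof -
  let ?c = "ennreal (2 * R / (real DIM('a) * R ^ DIM('a)))"
  let ?v = "unit_ball_vol (real DIM('a))"
  have v: "0 < ?v" by simp
  have "?c * (\<integral>\<^sup>+y. G y \<partial>lborel) = (\<integral>\<^sup>+y. ?c * G y \<partial>lborel)"
    by (simp add: nn_integral_cmult)
  also have "\<dots> \<le> (\<integral>\<^sup>+y. G y * indicator (- {0}) y * ennreal (norm y) *
      ennreal (2 / (real DIM('a) * norm y ^ DIM('a))) \<partial>lborel)"
  proof (rule nn_integral_mono_AE)
    show "AE y in lborel. ?c * G y \<le> G y * indicator (- {0}) y * ennreal (norm y) *
        ennreal (2 / (real DIM('a) * norm y ^ DIM('a)))"
      using AE_lborel_singleton [of "0::'a"]
    proof (rule eventually_mono)
      fix y :: 'a assume y: "y \<noteq> 0"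
      show "?c * G y \<le> G y * indicator (- {0}) y * ennreal (norm y) *
        ennreal (2 / (real DIM('a) * norm y ^ DIM('a)))"
      proof (cases "R < norm y")
        case False
        obtain k where k: "DIM('a) = Suc k" using DIM_positive [where 'a = 'a] by (metis Suc_pred)
        have *: "2 * \<rho> / (real DIM('a) * \<rho> ^ DIM('a)) = 2 / (real DIM('a) * \<rho> ^ k)" if "0 < \<rho>" for \<rho>
          using that unfolding k by simp
        have "2 * R / (real DIM('a) * R ^ DIM('a)) \<le> 2 * norm y / (real DIM('a) * norm y ^ DIM('a))"
          using R y False
          by (subst (1 2) *) (auto intro!: divide_left_mono mult_left_mono power_mono mult_pos_pos)
        then have "?c \<le> ennreal (norm y) * ennreal (2 / (real DIM('a) * norm y ^ DIM('a)))"
          by (subst ennreal_mult [symmetric]) (auto intro!: ennreal_leI simp: mult_ac)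
        then have "?c * G y \<le> (ennreal (norm y) * ennreal (2 / (real DIM('a) * norm y ^ DIM('a)))) * G y"
          by (rule mult_right_mono) simp
        then show ?thesis using y by (simp add: mult_ac)
      qed (simp add: G)
    qed
  qed
  finally have "?c * (\<integral>\<^sup>+y. G y \<partial>lborel) / ennreal ?v
      \<le> (\<integral>\<^sup>+u. (\<integral>\<^sup>+s. G (s *\<^sub>R u) \<partial>lborel) \<partial>uniform_sphere)"
    unfolding nn_integral_uniform_sphere_lines [OF assms(1)] by (rule divide_right_mono_ennreal)
  moreover have "?c / ennreal ?v = ennreal (2 * R / (real DIM('a) * (?v * R ^ DIM('a))))"
    using v R by (simp add: divide_ennreal mult_ac)
  ultimately show ?thesis
    by (metis ennreal_times_divide mult.commute)
qed

section \<open>Independent random directions\<close>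

text \<open>The level may depend on the parameter: this covers measurability in the directions at a
  fixed level as well as joint measurability in outcome and level, the latter for Fubini.\<close>

lemma borel_measurable_emeasure_sym_diff:
  fixes F G :: "'p \<Rightarrow> 'a::euclidean_space \<Rightarrow> real"
  assumes [measurable]: "(\<lambda>(p, x). F p x) \<in> borel_measurable (P \<Otimes>\<^sub>M borel)"
    "(\<lambda>(p, x). G p x) \<in> borel_measurable (P \<Otimes>\<^sub>M borel)" "\<tau> \<in> borel_measurable P"
  shows "(\<lambda>p. emeasure lborel (sym_diff {x. \<tau> p < F p x} {x. \<tau> p < G p x})) \<in> borel_measurable P"
proof -
  define F' where "F' = (\<lambda>(p, x). F p x)"
  define G' where "G' = (\<lambda>(p, x). G p x)"
  have [measurable]: "F' \<in> borel_measurable (P \<Otimes>\<^sub>M borel)" "G' \<in> borel_measurable (P \<Otimes>\<^sub>M borel)"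
    using assms by (simp_all add: F'_def G'_def)
  define Q where "Q = {z \<in> space (P \<Otimes>\<^sub>M lborel). (\<tau> (fst z) < F' z) \<noteq> (\<tau> (fst z) < G' z)}"
  have "Q \<in> sets (P \<Otimes>\<^sub>M lborel)" unfolding Q_def by measurable
  then have "(\<lambda>p. emeasure lborel (Pair p -` Q)) \<in> borel_measurable P"
    by (rule lborel.measurable_emeasure_Pair)
  moreover have "Pair p -` Q = sym_diff {x. \<tau> p < F p x} {x. \<tau> p < G p x}" if "p \<in> space P" for p
    using that by (auto simp: Q_def F'_def G'_def space_pair_measure)
  ultimately show ?thesis by (subst measurable_cong) auto
qed

lemma borel_measurable_id_uniform_sphere:
  "(\<lambda>u. u) \<in> borel_measurable (uniform_sphere :: 'a::euclidean_space measure)"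
  by (rule borel_measurable_uniform_sphere) simp

text \<open>Fubini exchanges the mean over \<open>u\<close> with the integral over \<open>x\<close>
  in \<open>B - A\<close>; it remains to bound the mean slice length of \<open>A - B\<close> through
  a fixed \<open>x\<close> from below.\<close>

lemma steiner_expected_step:
  fixes g :: "'a::euclidean_space \<Rightarrow> real"
  assumes g: "admissible L C g" and L: "0 < L" and t: "0 < t" and r: "r \<le> L"
    and vol: "emeasure lborel (ball (0::'a) r) = emeasure lborel {x. t < g x}"
  defines "K \<equiv> real DIM('a) * measure lebesgue (ball (0::'a) (2 * L))"
  shows "(\<integral>\<^sup>+u. emeasure lborel (sym_diff {x. t < steiner u g x} (ball 0 r)) \<partial>uniform_sphere)
      + ennreal (1 / K) * (emeasure lborel (sym_diff {x. t < g x} (ball 0 r)))\<^sup>2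
    \<le> emeasure lborel (sym_diff {x. t < g x} (ball 0 r))"
proof -
  note [measurable] = borel_measurable_id_uniform_sphere
  interpret sph: prob_space "uniform_sphere :: 'a measure" by (rule prob_space_uniform_sphere)
  interpret sph_pair: pair_sigma_finite "uniform_sphere :: 'a measure" "lborel :: 'a measure" ..
  define A where "A = {x. t < g x}"
  define B where "B = ball (0::'a) r"
  have [measurable]: "A \<in> sets borel" "B \<in> sets borel"
    using admissibleD(1) [OF g] by (auto simp: A_def B_def sets_superlevel)
  define v where "v = unit_ball_vol (real DIM('a))"
  have v: "0 < v" by (simp add: v_def)
  define k where "k = real DIM('a) * (v * (2 * L) ^ DIM('a))"
  have K: "K = k" using L by (simp add: K_def k_def v_def content_ball)
  have k: "0 < k" using v L by (simp add: k_def)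
  have fin: "X \<subseteq> cball 0 L \<Longrightarrow> \<exists>m\<ge>0. emeasure lborel X = ennreal m" for X :: "'a set"
    using emeasure_mono [of X "cball 0 L" lborel] L
    by (cases "emeasure lborel X") (auto simp: emeasure_cball top_unique)
  have sub: "A \<subseteq> cball 0 L" "B \<subseteq> cball 0 L"
    using admissible_superlevel_subset [OF g t] r by (auto simp: A_def B_def)
  obtain a where a: "0 \<le> a" "emeasure lborel (A - B) = ennreal a" using fin [of "A - B"] sub by blast
  obtain b where b: "0 \<le> b" "emeasure lborel (B - A) = ennreal b" using fin [of "B - A"] sub by blast
  obtain c where c: "0 \<le> c" "emeasure lborel (A \<inter> B) = ennreal c" using fin [of "A \<inter> B"] sub by blast
  have "emeasure lborel A = ennreal a + ennreal c"
    using plus_emeasure [of "A - B" lborel "A \<inter> B"] a c by (simp add: Un_Diff_Int Int_Diff disjoint_iff)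
  moreover have "emeasure lborel B = ennreal b + ennreal c"
    using plus_emeasure [of "B - A" lborel "A \<inter> B"] b c
    by (simp add: Un_Diff_Int Int_Diff disjoint_iff Int_commute [of A B])
  ultimately have ab: "b = a"
    using vol a b c by (simp add: A_def [symmetric] B_def [symmetric] flip: ennreal_plus)
  have q: "emeasure lborel (sym_diff A B) = ennreal (2 * a)"
    using plus_emeasure [of "A - B" lborel "B - A"] a b ab
    by (simp add: disjoint_iff flip: ennreal_plus)
  let ?J = "\<lambda>u. \<integral>\<^sup>+x. indicator (B - A) x * line_emeasure u (A - B) x \<partial>lborel"
  let ?q' = "\<lambda>u. emeasure lborel (sym_diff {x. t < steiner u g x} B)"
  \<comment> \<open>Points of the ball of radius \<open>L\<close> are at most \<open>2 * L\<close>
    apart, so \<open>nn_integral_uniform_sphere_lines_ge\<close> applies with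
    \<open>R = 2 * L\<close> to \<open>A - B\<close> as seen from \<open>x\<close>.\<close>
  have avg: "ennreal (4 * L / k) * ennreal a \<le> (\<integral>\<^sup>+u. line_emeasure u (A - B) x \<partial>uniform_sphere)"
    if x: "x \<in> B" for x
  proof -
    let ?G = "\<lambda>y. indicator (A - B) (x + y) :: ennreal"
    have "?G y = 0" if "2 * L < norm y" for y
    proof -
      have "norm y \<le> norm (x + y) + norm x" by (metis add_diff_cancel_left' norm_triangle_ineq4)
      moreover have "norm x \<le> L" using x sub(2) by auto
      ultimately have "x + y \<notin> cball 0 L" using that by simp
      then have "x + y \<notin> A" using sub(1) by blast
      then show ?thesis by simp
    qed
    then have "ennreal (2 * (2 * L) / (real DIM('a) * (unit_ball_vol (real DIM('a)) * (2 * L) ^ DIM('a))))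
        * (\<integral>\<^sup>+y. ?G y \<partial>lborel) \<le> (\<integral>\<^sup>+u. (\<integral>\<^sup>+s. ?G (s *\<^sub>R u) \<partial>lborel) \<partial>uniform_sphere)"
      using L by (intro nn_integral_uniform_sphere_lines_ge) auto
    also have "(\<integral>\<^sup>+y. ?G y \<partial>lborel) = ennreal a"
      by (subst nn_integral_lborel_shift) (simp_all add: a)
    finally show ?thesis by (simp add: k_def v_def line_emeasure_eq)
  qed
  have "ennreal (4 * L / k) * ennreal a * ennreal a = (\<integral>\<^sup>+x. indicator (B - A) x * (ennreal (4 * L / k) * ennreal a) \<partial>lborel)"
    using b ab by (simp add: nn_integral_multc mult.commute)
  also have "\<dots> \<le> (\<integral>\<^sup>+x. indicator (B - A) x * (\<integral>\<^sup>+u. line_emeasure u (A - B) x \<partial>uniform_sphere) \<partial>lborel)"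
    using avg by (intro nn_integral_mono) (auto simp: indicator_def)
  also have "\<dots> = (\<integral>\<^sup>+x. (\<integral>\<^sup>+u. indicator (B - A) x * line_emeasure u (A - B) x \<partial>uniform_sphere) \<partial>lborel)"
    by (intro nn_integral_cong nn_integral_cmult [symmetric]) measurable
  also have "\<dots> = (\<integral>\<^sup>+u. ?J u \<partial>uniform_sphere)"
    by (rule sph_pair.Fubini') measurable
  finally have J: "ennreal (4 * L / k) * ennreal a * ennreal a \<le> (\<integral>\<^sup>+u. ?J u \<partial>uniform_sphere)" .
  have [measurable]: "?q' \<in> borel_measurable uniform_sphere"
  proof -
    \<comment> \<open>\<open>B\<close> is written as a superlevel set at level \<open>t\<close> to
      fit \<open>borel_measurable_emeasure_sym_diff\<close>; the height \<open>t + 1\<close> is just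
      some number above \<open>t\<close>.\<close>
    have "(\<lambda>u. emeasure lborel (sym_diff {x. t < steiner u g x} {x. t < (t + 1) * indicator B x}))
        \<in> borel_measurable uniform_sphere"
    proof (rule borel_measurable_emeasure_sym_diff)
      show "(\<lambda>(u, x). steiner u g x) \<in> borel_measurable (uniform_sphere \<Otimes>\<^sub>M borel)"
        using admissibleD(1) [OF g]
        by (intro borel_measurable_steiner [OF _ _ _ g]) (auto simp: space_uniform_sphere)
    qed measurable
    moreover have "{x. t < (t + 1) * indicator B x} = B" using t by (auto simp: indicator_def)
    ultimately show ?thesis by simp
  qed
  have "ennreal (1 / K) * (ennreal (2 * a))\<^sup>2 = ennreal (1 / L) * (ennreal (4 * L / k) * ennreal a * ennreal a)"
    using a k L unfolding K by (simp add: ennreal_power ennreal_mult [symmetric] power2_eq_square)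
  also have "\<dots> \<le> ennreal (1 / L) * (\<integral>\<^sup>+u. ?J u \<partial>uniform_sphere)"
    by (intro mult_left_mono J) simp
  finally have "(\<integral>\<^sup>+u. ?q' u \<partial>uniform_sphere) + ennreal (1 / K) * (ennreal (2 * a))\<^sup>2
      \<le> (\<integral>\<^sup>+u. ?q' u \<partial>uniform_sphere) + ennreal (1 / L) * (\<integral>\<^sup>+u. ?J u \<partial>uniform_sphere)"
    by (rule add_left_mono)
  also have "\<dots> = (\<integral>\<^sup>+u. ?q' u + ennreal (1 / L) * ?J u \<partial>uniform_sphere)"
    by (subst nn_integral_add) (simp_all add: nn_integral_cmult)
  also have "\<dots> \<le> (\<integral>\<^sup>+u. ennreal (2 * a) \<partial>(uniform_sphere :: 'a measure))"
    using steiner_defect_step [OF g L _ t r]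
    by (intro nn_integral_mono) (simp add: space_uniform_sphere q [symmetric] A_def B_def)
  also have "\<dots> = ennreal (2 * a)" by (simp add: sph.emeasure_space_1)
  finally show ?thesis using q by (simp add: A_def B_def)
qed

text \<open>A discrete form of \<open>e' = - e^2 / K\<close>. With \<open>x = e n / K\<close>,
  nonnegativity of the next term forces \<open>x <= 1\<close>, and then \<open>n x <= 1\<close>
  implies \<open>(n + 1) (x - x^2) <= 1\<close>. Multiplying by \<open>n\<close> instead of dividing
  makes the base case trivial.\<close>

lemma quadratic_decay:
  fixes e :: "nat \<Rightarrow> real"
  assumes K: "0 < K" and e: "\<And>n. 0 \<le> e n" and step: "\<And>n. e (Suc n) + (e n)\<^sup>2 / K \<le> e n"
  shows "real n * e n \<le> K"
proof (induction n)
  case (Suc n)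
  define x where "x = e n / K"
  have eK: "e n = K * x" using K by (simp add: x_def)
  have "(e n)\<^sup>2 / K = K * (x * x)" using K by (simp add: eK power2_eq_square)
  then have "K * (x * x) \<le> K * x" using step [of n] e [of "Suc n"] eK by linarith
  then have "x * x \<le> x * 1" by (simp only: mult_le_cancel_left_pos [OF K] mult_1_right)
  moreover have "0 \<le> x" using e [of n] K by (simp add: x_def)
  ultimately have x1: "x \<le> 1"
    using mult_left_le_imp_le [of x x 1] by (cases "x = 0") auto
  have nx: "real n * x \<le> 1" using Suc K by (simp add: x_def field_simps)
  have "real (Suc n) * (x - x * x) = 1 - ((1 - real n * x) * (1 - x) + x * x)" by (simp add: algebra_simps)
  also have "\<dots> \<le> 1"
    using mult_nonneg_nonneg [of "1 - real n * x" "1 - x"] x1 nx zero_le_square [of x] by linarith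
  finally have "real (Suc n) * (x - x * x) * K \<le> 1 * K" using K by (intro mult_right_mono) auto
  then have "real (Suc n) * ((x - x * x) * K) \<le> K" by (simp only: mult.assoc mult_1_left)
  moreover have "real (Suc n) * e (Suc n) \<le> real (Suc n) * ((x - x * x) * K)"
    using step [of n] K by (intro mult_left_mono) (auto simp: eK power2_eq_square algebra_simps)
  ultimately show ?case by linarith
qed (use K in simp)

lemma steiner_iter_map_Suc:
  "steiner_iter (map V [1..<Suc (Suc n)]) f = steiner (V (Suc n)) (steiner_iter (map V [1..<Suc n]) f)"
  by (simp add: steiner_iter_def)

lemma admissible_steiner_iter:
  assumes "admissible L C g" "\<And>u. u \<in> set us \<Longrightarrow> norm u = 1"
  shows "admissible L C (steiner_iter us g)"
  using assms by (induction us arbitrary: g) (auto simp: steiner_iter_def admissible_steiner)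

text \<open>\<open>P\<close> is arbitrary because the lemma serves both for the probability space
  and for the product space carrying the direction vectors.\<close>

lemma borel_measurable_steiner_iter:
  fixes V :: "nat \<Rightarrow> 'p \<Rightarrow> 'a::euclidean_space"
  assumes g: "admissible L C g"
    and V: "\<And>i. i \<in> {1..n} \<Longrightarrow> V i \<in> measurable P (restrict_space borel (sphere 0 1))"
  shows "(\<lambda>(p, x). steiner_iter (map (\<lambda>i. V i p) [1..<Suc n]) g x) \<in> borel_measurable (P \<Otimes>\<^sub>M borel)"
  using V
proof (induction n)
  case 0
  have [measurable]: "g \<in> borel_measurable borel" by (rule admissibleD [OF g])
  show ?case by (simp add: steiner_iter_def)
next
  case (Suc n)
  have norm: "norm (V i p) = 1" if "i \<in> {1..Suc n}" "p \<in> space P" for i p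
    using measurable_space [OF Suc.prems [OF that(1)] that(2)] by (simp add: space_restrict_space)
  have "V (Suc n) \<in> borel_measurable P"
    using Suc.prems [of "Suc n"] by (auto simp: measurable_restrict_space2_iff)
  moreover have "(\<lambda>(p, x). steiner_iter (map (\<lambda>i. V i p) [1..<Suc n]) g x) \<in> borel_measurable (P \<Otimes>\<^sub>M borel)"
    by (rule Suc.IH) (rule Suc.prems, simp)
  ultimately show ?case
    unfolding steiner_iter_map_Suc
    by (rule borel_measurable_steiner) (auto intro!: norm admissible_steiner_iter [OF g])
qed

locale random_directions = prob_space M for M :: "'w measure" +
  fixes U :: "nat \<Rightarrow> 'w \<Rightarrow> 'a::euclidean_space"
  assumes indep: "indep_vars (\<lambda>_. restrict_space borel (sphere 0 1)) U {1..}"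
    and distr_U: "\<And>i. i \<ge> 1 \<Longrightarrow> distr M (restrict_space borel (sphere 0 1)) (U i) = uniform_sphere"
begin

definition dirs :: "nat \<Rightarrow> 'w \<Rightarrow> 'a list" where
  "dirs n \<omega> = map (\<lambda>i. U i \<omega>) [1..<Suc n]"

lemma measurable_U: "1 \<le> i \<Longrightarrow> U i \<in> measurable M (restrict_space borel (sphere 0 1))"
  using indep by (auto simp: indep_vars_def)

lemma norm_dirs: "\<omega> \<in> space M \<Longrightarrow> u \<in> set (dirs n \<omega>) \<Longrightarrow> norm u = 1"
  using measurable_space [OF measurable_U] by (auto simp: dirs_def space_restrict_space)

text \<open>By independence the first \<open>n\<close> directions and the next one have a product
  law, so the next one can be averaged with the others frozen.\<close>

lemma nn_integral_next_direction:
  assumes [measurable]: "\<Psi> \<in> borel_measurable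
      (PiM {1..n} (\<lambda>_. restrict_space borel (sphere 0 1)) \<Otimes>\<^sub>M (uniform_sphere :: 'a measure))"
  shows "(\<integral>\<^sup>+\<omega>. \<Psi> (restrict (\<lambda>i. U i \<omega>) {1..n}, U (Suc n) \<omega>) \<partial>M)
       = (\<integral>\<^sup>+\<omega>. (\<integral>\<^sup>+u. \<Psi> (restrict (\<lambda>i. U i \<omega>) {1..n}, u) \<partial>uniform_sphere) \<partial>M)"
proof -
  interpret sph: prob_space "uniform_sphere :: 'a measure" by (rule prob_space_uniform_sphere)
  let ?S = "restrict_space borel (sphere (0::'a) 1)"
  let ?P = "PiM {1..n} (\<lambda>_. ?S)"
  let ?X = "\<lambda>\<omega>. restrict (\<lambda>i. U i \<omega>) {1..n}"
  \<comment> \<open>\<open>indep_var_restrict\<close> yields independence of families, so the single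
    direction is first treated as a family over \<open>{Suc n}\<close>; \<open>last\<close> undoes
    this.\<close>
  let ?Q = "PiM {Suc n} (\<lambda>_. ?S)"
  let ?Y = "\<lambda>\<omega>. restrict (\<lambda>i. U i \<omega>) {Suc n}"
  have ind: "indep_var ?P ?X ?Q ?Y"
    by (rule indep_var_restrict [OF indep]) auto
  then have XY [measurable]: "?X \<in> measurable M ?P" "?Y \<in> measurable M ?Q"
    by (auto dest: indep_var_rv1 indep_var_rv2)
  have [measurable]: "U (Suc n) \<in> measurable M ?S" by (rule measurable_U) simp
  have comp [measurable]: "(\<lambda>w. w (Suc n)) \<in> measurable ?Q ?S" by (rule measurable_component_singleton) simp
  interpret Y: prob_space "distr M ?Q ?Y" by (rule prob_space_distr) measurable
  have eq: "distr M ?P ?X \<Otimes>\<^sub>M distr M ?Q ?Y = distr M (?P \<Otimes>\<^sub>M ?Q) (\<lambda>\<omega>. (?X \<omega>, ?Y \<omega>))"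
    using ind by (simp add: indep_var_distribution_eq)
  have \<Psi> [measurable]: "\<Psi> \<in> borel_measurable (?P \<Otimes>\<^sub>M ?S)"
    using assms by (simp cong: measurable_cong_sets sets_pair_measure_cong add: sets_uniform_sphere)
  have \<Psi>' [measurable]: "(\<lambda>z. \<Psi> (fst z, snd z (Suc n))) \<in> borel_measurable (?P \<Otimes>\<^sub>M ?Q)"
    by (rule measurable_compose [OF _ \<Psi>]) measurable
  have last: "(\<integral>\<^sup>+w. \<Psi> (v, w (Suc n)) \<partial>distr M ?Q ?Y) = (\<integral>\<^sup>+u. \<Psi> (v, u) \<partial>uniform_sphere)"
    if "v \<in> space ?P" for v
  proof -
    have \<Psi>v [measurable]: "(\<lambda>u. \<Psi> (v, u)) \<in> borel_measurable ?S"
      by (rule measurable_Pair2 [OF \<Psi> that])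
    have [measurable]: "(\<lambda>w. \<Psi> (v, w (Suc n))) \<in> borel_measurable ?Q"
      by (rule measurable_compose [OF comp \<Psi>v])
    have "(\<integral>\<^sup>+w. \<Psi> (v, w (Suc n)) \<partial>distr M ?Q ?Y) = (\<integral>\<^sup>+\<omega>. \<Psi> (v, U (Suc n) \<omega>) \<partial>M)"
      by (subst nn_integral_distr [OF XY(2)]) simp_all
    also have "\<dots> = (\<integral>\<^sup>+u. \<Psi> (v, u) \<partial>distr M ?S (U (Suc n)))"
      using \<Psi>v by (subst nn_integral_distr) simp_all
    finally show ?thesis by (simp add: distr_U)
  qed
  have "(\<integral>\<^sup>+\<omega>. \<Psi> (?X \<omega>, U (Suc n) \<omega>) \<partial>M) =
      (\<integral>\<^sup>+z. \<Psi> (fst z, snd z (Suc n)) \<partial>distr M (?P \<Otimes>\<^sub>M ?Q) (\<lambda>\<omega>. (?X \<omega>, ?Y \<omega>)))"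
    by (subst nn_integral_distr [OF measurable_Pair [OF XY]]) (use \<Psi>' in simp_all)
  also have "\<dots> = (\<integral>\<^sup>+z. \<Psi> (fst z, snd z (Suc n)) \<partial>(distr M ?P ?X \<Otimes>\<^sub>M distr M ?Q ?Y))"
    by (simp only: eq)
  also have "\<dots> = (\<integral>\<^sup>+v. (\<integral>\<^sup>+w. \<Psi> (v, w (Suc n)) \<partial>distr M ?Q ?Y) \<partial>distr M ?P ?X)"
    using Y.nn_integral_fst [of "\<lambda>z. \<Psi> (fst z, snd z (Suc n))" "distr M ?P ?X"] \<Psi>'
    by (simp cong: measurable_cong_sets sets_pair_measure_cong)
  also have "\<dots> = (\<integral>\<^sup>+v. (\<integral>\<^sup>+u. \<Psi> (v, u) \<partial>uniform_sphere) \<partial>distr M ?P ?X)"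
    by (intro nn_integral_cong last) simp
  also have "\<dots> = (\<integral>\<^sup>+\<omega>. (\<integral>\<^sup>+u. \<Psi> (?X \<omega>, u) \<partial>uniform_sphere) \<partial>M)"
    by (rule nn_integral_distr) measurable
  finally show ?thesis .
qed

end

section \<open>Volumes of level sets and the layer-cake formula\<close>

lemma emeasure_steiner_iter_superlevel:
  assumes "admissible L C g" "0 < t" "\<And>u. u \<in> set us \<Longrightarrow> norm u = 1"
  shows "emeasure lborel {x. t < steiner_iter us g x} = emeasure lborel {x. t < g x}"
  using assms
proof (induction us arbitrary: g)
  case (Cons u us)
  then show ?case
    using Cons.IH [of "steiner u g"] admissible_steiner [of L C g u] emeasure_steiner_superlevel [of L C g u t]
    by (simp add: steiner_iter_def)
qed (simp add: steiner_iter_def)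

text \<open>The separating levels form the half-open interval from the minimum to the maximum;
  intersecting with \<open>{0<..<C}\<close> loses at most the level 0.\<close>

lemma abs_diff_layer_cake:
  fixes a b :: real
  assumes "0 \<le> a" "a \<le> C" "0 \<le> b" "b \<le> C"
  shows "ennreal \<bar>a - b\<bar> = (\<integral>\<^sup>+t. indicator {0<..<C} t * indicator {t. (t < a) \<noteq> (t < b)} t \<partial>lborel)"
proof -
  have "ennreal \<bar>a - b\<bar> = emeasure lborel {min a b..<max a b}" by (simp add: min_def max_def abs_real_def)
  also have "\<dots> = (\<integral>\<^sup>+t. indicator {min a b..<max a b} t \<partial>lborel)" by simp
  also have "\<dots> = (\<integral>\<^sup>+t. indicator {0<..<C} t * indicator {t. (t < a) \<noteq> (t < b)} t \<partial>lborel)"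
    using assms
    by (intro nn_integral_cong_AE eventually_mono [OF AE_lborel_singleton [of "0::real"]])
      (auto simp: indicator_def min_def max_def split: if_splits)
  finally show ?thesis .
qed

lemma L1_norm_layer_cake:
  fixes f g :: "'a::euclidean_space \<Rightarrow> real"
  assumes [measurable]: "f \<in> borel_measurable borel" "g \<in> borel_measurable borel"
    and "\<And>x. 0 \<le> f x \<and> f x \<le> C" "\<And>x. 0 \<le> g x \<and> g x \<le> C"
  shows "L1_norm (\<lambda>x. f x - g x) =
    (\<integral>\<^sup>+t. indicator {0<..<C} t * emeasure lborel (sym_diff {x. t < f x} {x. t < g x}) \<partial>lborel)"
proof -
  have "L1_norm (\<lambda>x. f x - g x) = (\<integral>\<^sup>+x. ennreal \<bar>f x - g x\<bar> \<partial>lborel)"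
    unfolding L1_norm_def by (rule nn_integral_completion)
  also have "\<dots> = (\<integral>\<^sup>+x. (\<integral>\<^sup>+t. indicator {0<..<C} t * indicator {t. (t < f x) \<noteq> (t < g x)} t \<partial>lborel) \<partial>lborel)"
    using assms(3,4) by (intro nn_integral_cong abs_diff_layer_cake) auto
  also have "\<dots> = (\<integral>\<^sup>+t. (\<integral>\<^sup>+x. indicator {0<..<C} t * indicator {t. (t < f x) \<noteq> (t < g x)} t \<partial>lborel) \<partial>lborel)"
    by (rule lborel_pair.Fubini') (simp only: indicator_def mem_Collect_eq, measurable)
  also have "\<dots> = (\<integral>\<^sup>+t. indicator {0<..<C} t * emeasure lborel (sym_diff {x. t < f x} {x. t < g x}) \<partial>lborel)"
  proof (intro nn_integral_cong)
    fix t :: real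
    have eq: "indicator {t. (t < f x) \<noteq> (t < g x)} t = (indicator (sym_diff {x. t < f x} {x. t < g x}) x :: ennreal)" for x
      by (auto simp: indicator_def)
    show "(\<integral>\<^sup>+x. indicator {0<..<C} t * indicator {t. (t < f x) \<noteq> (t < g x)} t \<partial>lborel) =
        indicator {0<..<C} t * emeasure lborel (sym_diff {x. t < f x} {x. t < g x})"
      unfolding eq by (simp add: nn_integral_cmult)
  qed
  finally show ?thesis .
qed

section \<open>Expected defect of level sets and the \<open>L^1\<close> estimate\<close>

context random_directions
begin

context
  fixes g :: "'a \<Rightarrow> real" and L C :: real
  assumes g: "admissible L C g" and L: "0 < L"
begin

lemma admissible_dirs: "\<omega> \<in> space M \<Longrightarrow> admissible L C (steiner_iter (dirs n \<omega>) g)"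
  by (intro admissible_steiner_iter [OF g] norm_dirs)

lemma borel_measurable_steiner_iter_dirs:
  "(\<lambda>(\<omega>, x). steiner_iter (dirs n \<omega>) g x) \<in> borel_measurable (M \<Otimes>\<^sub>M borel)"
  unfolding dirs_def by (intro borel_measurable_steiner_iter [OF g] measurable_U) auto

lemma borel_measurable_rearr: "symm_rearr g \<in> borel_measurable borel"
  by (rule bounded_vanishing.borel_measurable_symm_rearr [OF admissible_bounded_vanishing [OF g]])

lemma rearr_bounds: "0 \<le> symm_rearr g x" "symm_rearr g x \<le> C"
  using bounded_vanishing.symm_rearr_nonneg [OF admissible_bounded_vanishing [OF g]]
    bounded_vanishing.symm_rearr_le [OF admissible_bounded_vanishing [OF g]] by auto

definition defect :: "real \<Rightarrow> nat \<Rightarrow> 'w \<Rightarrow> ennreal" where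
  "defect t n \<omega> = emeasure lborel (sym_diff {x. t < steiner_iter (dirs n \<omega>) g x} {x. t < symm_rearr g x})"

lemma borel_measurable_defect:
  "(\<lambda>(\<omega>, t). defect t n \<omega>) \<in> borel_measurable (M \<Otimes>\<^sub>M borel)"
  unfolding defect_def case_prod_beta
proof (rule borel_measurable_emeasure_sym_diff)
  have "(\<lambda>z. (\<lambda>(\<omega>, x). steiner_iter (dirs n \<omega>) g x) (fst (fst z), snd z))
      \<in> borel_measurable ((M \<Otimes>\<^sub>M (borel :: real measure)) \<Otimes>\<^sub>M borel)"
    by (rule measurable_compose [OF _ borel_measurable_steiner_iter_dirs]) measurable
  then show "(\<lambda>(p, x). steiner_iter (dirs n (fst p)) g x) \<in> borel_measurable ((M \<Otimes>\<^sub>M (borel :: real measure)) \<Otimes>\<^sub>M borel)"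
    by (simp add: case_prod_beta)
  show "(\<lambda>(p, x). symm_rearr g x) \<in> borel_measurable ((M \<Otimes>\<^sub>M (borel :: real measure)) \<Otimes>\<^sub>M borel)"
    using borel_measurable_rearr by measurable
qed measurable

lemma borel_measurable_defect' [measurable]: "defect t n \<in> borel_measurable M"
  using measurable_Pair1 [OF borel_measurable_defect [of n], of t] by simp

text \<open>For given first directions \<open>steiner_expected_step\<close> applies to the current
  function, whose level sets still have the volume of those of \<open>g\<close>. Averaging over
  these directions leaves only the square to be taken out of the mean.\<close>

lemma expected_defect_step:
  fixes n :: nat and t :: real
  assumes t: "0 < t"
  defines "K \<equiv> real DIM('a) * measure lebesgue (ball (0::'a) (2 * L))"
  shows "(\<integral>\<^sup>+\<omega>. defect t (Suc n) \<omega> \<partial>M) + ennreal (1 / K) * (\<integral>\<^sup>+\<omega>. defect t n \<omega> \<partial>M)\<^sup>2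
    \<le> (\<integral>\<^sup>+\<omega>. defect t n \<omega> \<partial>M)"
proof -
  obtain r where r: "0 \<le> r" "r \<le> L" "{x. t < symm_rearr g x} = ball 0 r"
    "emeasure lborel (ball (0::'a) r) = emeasure lborel {x. t < g x}"
    by (rule symm_rearr_superlevel [OF g t])
  let ?S = "restrict_space borel (sphere (0::'a) 1)"
  let ?P = "PiM {1..n} (\<lambda>_. ?S)"
  let ?F = "\<lambda>v. steiner_iter (map v [1..<Suc n]) g"
  let ?Q = "\<lambda>h. emeasure lborel (sym_diff {x. t < h x} (ball (0::'a) r))"
  \<comment> \<open>A function of the direction vector instead of the outcome, as
    \<open>nn_integral_next_direction\<close> requires.\<close>
  define \<Psi> where "\<Psi> = (\<lambda>p. ?Q (steiner (snd p) (?F (fst p))))"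
  have map_restrict: "map (restrict V {1..n}) [1..<Suc n] = map V [1..<Suc n]" for V :: "nat \<Rightarrow> 'a"
    by (intro map_cong) auto
  have [measurable]: "\<Psi> \<in> borel_measurable (?P \<Otimes>\<^sub>M (uniform_sphere :: 'a measure))"
  proof -
    note [measurable] = borel_measurable_id_uniform_sphere
    have comp: "(\<lambda>p. fst p i) \<in> measurable (?P \<Otimes>\<^sub>M (uniform_sphere :: 'a measure)) ?S" if "i \<in> {1..n}" for i
      by (rule measurable_compose [OF measurable_fst measurable_component_singleton [OF that]])
    have "norm (fst p i) = 1" if "i \<in> {1..n}" "p \<in> space (?P \<Otimes>\<^sub>M (uniform_sphere :: 'a measure))" for i p
      using measurable_space [OF comp [OF that(1)] that(2)] by (simp add: space_restrict_space)
    then have "(\<lambda>(p, x). steiner (snd p) (?F (fst p)) x) \<in>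
        borel_measurable ((?P \<Otimes>\<^sub>M (uniform_sphere :: 'a measure)) \<Otimes>\<^sub>M borel)"
      using borel_measurable_steiner_iter [OF g, where V = "\<lambda>i p. fst p i", OF comp]
      by (intro borel_measurable_steiner [where L = L and C = C] admissible_steiner_iter [OF g])
        (auto simp: space_pair_measure space_uniform_sphere)
    then have "(\<lambda>p. emeasure lborel (sym_diff {x. t < steiner (snd p) (?F (fst p)) x}
        {x. t < symm_rearr g x})) \<in> borel_measurable (?P \<Otimes>\<^sub>M (uniform_sphere :: 'a measure))"
    proof (rule borel_measurable_emeasure_sym_diff)
      show "(\<lambda>(p, x). symm_rearr g x) \<in> borel_measurable ((?P \<Otimes>\<^sub>M (uniform_sphere :: 'a measure)) \<Otimes>\<^sub>M borel)"
        using borel_measurable_rearr by measurable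
    qed measurable
    then show ?thesis by (simp add: \<Psi>_def r(3))
  qed
  have "(\<integral>\<^sup>+\<omega>. defect t (Suc n) \<omega> \<partial>M) = (\<integral>\<^sup>+\<omega>. \<Psi> (restrict (\<lambda>i. U i \<omega>) {1..n}, U (Suc n) \<omega>) \<partial>M)"
    by (simp only: defect_def dirs_def \<Psi>_def steiner_iter_map_Suc r(3) fst_conv snd_conv map_restrict)
  also have "\<dots> = (\<integral>\<^sup>+\<omega>. (\<integral>\<^sup>+u. \<Psi> (restrict (\<lambda>i. U i \<omega>) {1..n}, u) \<partial>uniform_sphere) \<partial>M)"
    by (rule nn_integral_next_direction) measurable
  also have "\<dots> = (\<integral>\<^sup>+\<omega>. (\<integral>\<^sup>+u. ?Q (steiner u (steiner_iter (dirs n \<omega>) g)) \<partial>uniform_sphere) \<partial>M)"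
    by (simp only: dirs_def \<Psi>_def fst_conv snd_conv map_restrict)
  finally have next_eq: "(\<integral>\<^sup>+\<omega>. defect t (Suc n) \<omega> \<partial>M) =
    (\<integral>\<^sup>+\<omega>. (\<integral>\<^sup>+u. ?Q (steiner u (steiner_iter (dirs n \<omega>) g)) \<partial>uniform_sphere) \<partial>M)" .
  have step: "(\<integral>\<^sup>+u. ?Q (steiner u (steiner_iter (dirs n \<omega>) g)) \<partial>uniform_sphere)
      + ennreal (1 / K) * (defect t n \<omega>)\<^sup>2 \<le> defect t n \<omega>" if \<omega>: "\<omega> \<in> space M" for \<omega>
  proof -
    have "emeasure lborel (ball (0::'a) r) = emeasure lborel {x. t < steiner_iter (dirs n \<omega>) g x}"
      using r(4) emeasure_steiner_iter_superlevel [OF g t norm_dirs [OF \<omega>]] by simp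
    then show ?thesis
      using steiner_expected_step [OF admissible_dirs [OF \<omega>] L t r(2)]
      by (simp only: defect_def r(3) K_def)
  qed
  \<comment> \<open>Jensen's inequality for the square, as Cauchy-Schwarz against the constant
    1.\<close>
  have "(\<integral>\<^sup>+\<omega>. defect t n \<omega> \<partial>M)\<^sup>2 \<le> (\<integral>\<^sup>+\<omega>. (defect t n \<omega>)\<^sup>2 \<partial>M)"
    using Cauchy_Schwarz_nn_integral [of "defect t n" M "\<lambda>_. 1"] by (simp add: emeasure_space_1)
  then have "(\<integral>\<^sup>+\<omega>. defect t (Suc n) \<omega> \<partial>M) + ennreal (1 / K) * (\<integral>\<^sup>+\<omega>. defect t n \<omega> \<partial>M)\<^sup>2
     \<le> (\<integral>\<^sup>+\<omega>. defect t (Suc n) \<omega> \<partial>M) + ennreal (1 / K) * (\<integral>\<^sup>+\<omega>. (defect t n \<omega>)\<^sup>2 \<partial>M)"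
    by (intro add_left_mono mult_left_mono) auto
  also have "\<dots> = (\<integral>\<^sup>+\<omega>. (\<integral>\<^sup>+u. ?Q (steiner u (steiner_iter (dirs n \<omega>) g)) \<partial>uniform_sphere) \<partial>M)
      + (\<integral>\<^sup>+\<omega>. ennreal (1 / K) * (defect t n \<omega>)\<^sup>2 \<partial>M)"
    by (simp add: next_eq nn_integral_cmult)
  also have "\<dots> = (\<integral>\<^sup>+\<omega>. (\<integral>\<^sup>+u. ?Q (steiner u (steiner_iter (dirs n \<omega>) g)) \<partial>uniform_sphere)
      + ennreal (1 / K) * (defect t n \<omega>)\<^sup>2 \<partial>M)"
  proof (rule nn_integral_add [symmetric])
    interpret sph: prob_space "uniform_sphere :: 'a measure" by (rule prob_space_uniform_sphere)
    \<comment> \<open>Measurability of the conditional mean is obtained by factoring it through the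
      vector of the first \<open>n\<close> directions.\<close>
    have X: "(\<lambda>\<omega>. restrict (\<lambda>i. U i \<omega>) {1..n}) \<in> measurable M ?P"
      by (intro measurable_restrict measurable_U) auto
    have "(\<lambda>v. \<integral>\<^sup>+u. \<Psi> (v, u) \<partial>uniform_sphere) \<in> borel_measurable ?P"
      by measurable
    from measurable_compose [OF X this]
    have "(\<lambda>\<omega>. \<integral>\<^sup>+u. \<Psi> (restrict (\<lambda>i. U i \<omega>) {1..n}, u) \<partial>uniform_sphere) \<in> borel_measurable M" .
    then show "(\<lambda>\<omega>. \<integral>\<^sup>+u. ?Q (steiner u (steiner_iter (dirs n \<omega>) g)) \<partial>uniform_sphere) \<in> borel_measurable M"
      by (simp only: dirs_def \<Psi>_def fst_conv snd_conv map_restrict)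
  qed measurable
  also have "\<dots> \<le> (\<integral>\<^sup>+\<omega>. defect t n \<omega> \<partial>M)"
    by (intro nn_integral_mono step)
  finally show ?thesis .
qed

lemma expected_defect_le:
  fixes n :: nat and t :: real
  assumes t: "0 < t" and n: "1 \<le> n"
  defines "K \<equiv> real DIM('a) * measure lebesgue (ball (0::'a) (2 * L))"
  shows "(\<integral>\<^sup>+\<omega>. defect t n \<omega> \<partial>M) \<le> ennreal (K / real n)"
proof -
  have K: "0 < K" using L unit_ball_vol_pos [of "real DIM('a)"]
    by (simp add: K_def content_ball del: unit_ball_vol_pos)
  obtain r where r: "0 \<le> r" "r \<le> L" "{x. t < symm_rearr g x} = ball 0 r"
    by (rule symm_rearr_superlevel [OF g t])
  define e where "e n = enn2real (\<integral>\<^sup>+\<omega>. defect t n \<omega> \<partial>M)" for n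
  \<comment> \<open>All level sets lie in the ball of radius \<open>L\<close>, so the means are
    finite and the recursion can be read in the reals.\<close>
  have "(\<integral>\<^sup>+\<omega>. defect t n \<omega> \<partial>M) < \<infinity>" for n
  proof -
    have "defect t n \<omega> \<le> emeasure lborel (cball (0::'a) L)" if "\<omega> \<in> space M" for \<omega>
      using admissible_superlevel_subset [OF admissible_dirs [OF that] t] r
      unfolding defect_def by (intro emeasure_mono) auto
    then have "(\<integral>\<^sup>+\<omega>. defect t n \<omega> \<partial>M) \<le> (\<integral>\<^sup>+\<omega>. emeasure lborel (cball (0::'a) L) \<partial>M)"
      by (rule nn_integral_mono)
    also have "\<dots> < \<infinity>" using L by (simp add: emeasure_space_1 emeasure_cball)
    finally show ?thesis .
  qed
  then have e: "(\<integral>\<^sup>+\<omega>. defect t n \<omega> \<partial>M) = ennreal (e n)" "0 \<le> e n" for n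
    by (simp_all add: e_def)
  have "e (Suc n) + (e n)\<^sup>2 / K \<le> e n" for n
  proof -
    have "ennreal (e (Suc n) + (e n)\<^sup>2 / K) = ennreal (e (Suc n)) + ennreal (1 / K) * (ennreal (e n))\<^sup>2"
      using e(2) K by (simp add: ennreal_power ennreal_mult [symmetric])
    also have "\<dots> \<le> ennreal (e n)"
      using expected_defect_step [OF t, of n] by (simp only: e K_def)
    finally show ?thesis by (simp only: ennreal_le_iff [OF e(2)])
  qed
  then have "real n * e n \<le> K" by (rule quadratic_decay [OF K e(2)])
  then show ?thesis unfolding e(1) using n by (intro ennreal_leI) (simp add: field_simps)
qed

text \<open>The level-wise bound is uniform in \<open>t\<close>, and only levels between 0 and
  \<open>C\<close> contribute; this is how the sup bound enters.\<close>

lemma expected_L1_norm_le: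
  fixes n :: nat
  assumes n: "1 \<le> n"
  defines "K \<equiv> real DIM('a) * measure lebesgue (ball (0::'a) (2 * L))"
  shows "(\<integral>\<^sup>+\<omega>. L1_norm (\<lambda>x. steiner_iter (dirs n \<omega>) g x - symm_rearr g x) \<partial>M) \<le> ennreal (K * C / real n)"
proof -
  interpret M_pair: pair_sigma_finite M "lborel :: real measure" ..
  have "(\<integral>\<^sup>+\<omega>. L1_norm (\<lambda>x. steiner_iter (dirs n \<omega>) g x - symm_rearr g x) \<partial>M)
     = (\<integral>\<^sup>+\<omega>. (\<integral>\<^sup>+t. indicator {0<..<C} t * defect t n \<omega> \<partial>lborel) \<partial>M)"
    unfolding defect_def using admissibleD [OF admissible_dirs] borel_measurable_rearr rearr_bounds
    by (intro nn_integral_cong L1_norm_layer_cake) auto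
  also have "\<dots> = (\<integral>\<^sup>+t. (\<integral>\<^sup>+\<omega>. indicator {0<..<C} t * defect t n \<omega> \<partial>M) \<partial>lborel)"
  proof (rule M_pair.Fubini'[symmetric])
    note [measurable] = borel_measurable_defect [of n]
    have "(\<lambda>z. indicator {0<..<C} (snd z) * (\<lambda>(\<omega>, t). defect t n \<omega>) z) \<in> borel_measurable (M \<Otimes>\<^sub>M lborel)"
      by measurable
    then show "(\<lambda>(\<omega>, t). indicator {0<..<C} t * defect t n \<omega>) \<in> borel_measurable (M \<Otimes>\<^sub>M lborel)"
      by (simp add: case_prod_beta)
  qed
  also have "\<dots> \<le> (\<integral>\<^sup>+t. indicator {0<..<C} t * ennreal (K / real n) \<partial>lborel)"
    using expected_defect_le [OF _ n]
    by (intro nn_integral_mono) (auto simp: indicator_def K_def)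
  also have "\<dots> = ennreal (K * C / real n)"
    using admissibleD(3) [OF g]
    by (simp add: nn_integral_multc ennreal_mult [symmetric] K_def mult_ac)
  finally show ?thesis .
qed

end

end

section \<open>Modification on null sets\<close>

lemma borel_measurable_lebesgue_AE_cong:
  fixes f h :: "'a::euclidean_space \<Rightarrow> 'b::{second_countable_topology, linorder_topology}"
  assumes f: "f \<in> borel_measurable lebesgue" and eq: "AE x in lborel. h x = f x"
  shows "h \<in> borel_measurable lebesgue"
proof (rule borel_measurableI_greater)
  fix t
  have A: "{x \<in> space lebesgue. t < f x} \<in> sets lebesgue" using f by measurable
  have ae: "AE x in lebesgue. x \<in> {x \<in> space lebesgue. t < f x} \<longleftrightarrow> x \<in> {x \<in> space lebesgue. t < h x}"
    using AE_completion [OF eq] by (rule eventually_mono) simp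
  show "{x \<in> space lebesgue. t < h x} \<in> sets lebesgue"
    by (rule completion.in_sets_AE [OF ae A]) simp
qed

lemma emeasure_superlevel_AE_cong:
  fixes f h :: "'a::euclidean_space \<Rightarrow> real"
  assumes f: "f \<in> borel_measurable lebesgue" and eq: "AE x in lborel. h x = f x"
  shows "emeasure lebesgue {x. t < h x} = emeasure lebesgue {x. t < f x}"
proof -
  have "{x \<in> space lebesgue. t < f x} \<in> sets lebesgue" using f by measurable
  moreover have "{x \<in> space lebesgue. t < h x} \<in> sets lebesgue"
    using borel_measurable_lebesgue_AE_cong [OF assms] by measurable
  ultimately show ?thesis
    using AE_completion [OF eq] by (intro emeasure_eq_AE) (auto elim: eventually_mono)
qed

lemma symm_rearr_AE_cong:
  fixes f h :: "'a::euclidean_space \<Rightarrow> real"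
  assumes "f \<in> borel_measurable lebesgue" "AE x in lborel. h x = f x"
  shows "symm_rearr h = symm_rearr f"
  by (intro symm_rearr_cong emeasure_superlevel_AE_cong assms)

text \<open>By Fubini and translation invariance the total slice length is an integral over
  \<open>s\<close> of the volumes of translates of \<open>N\<close>, all of which are 0.\<close>

lemma AE_line_emeasure_0:
  fixes u :: "'a::euclidean_space"
  assumes N: "N \<in> null_sets lborel"
  shows "AE x in lborel. line_emeasure u N x = 0"
proof -
  have [measurable]: "N \<in> sets borel" and N0: "emeasure lborel N = 0" using N by (auto simp: null_sets_def)
  have "(\<integral>\<^sup>+x. line_emeasure u N x \<partial>lborel) = (\<integral>\<^sup>+x. (\<integral>\<^sup>+s. indicator N (x + s *\<^sub>R u) \<partial>lborel) \<partial>lborel)"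
    by (simp add: line_emeasure_eq)
  also have "\<dots> = (\<integral>\<^sup>+s. (\<integral>\<^sup>+x. indicator N (x + s *\<^sub>R u) \<partial>lborel) \<partial>lborel)"
    by (rule lborel_pair.Fubini') measurable
  also have "\<dots> = (\<integral>\<^sup>+s. (\<integral>\<^sup>+x. indicator N (s *\<^sub>R u + x) \<partial>lborel) \<partial>lborel)"
    by (simp only: add.commute)
  also have "\<dots> = 0" by (subst nn_integral_lborel_shift) (simp_all add: N0)
  finally show ?thesis by (subst (asm) nn_integral_0_iff_AE) auto
qed

text \<open>For almost every point the line through it meets the exceptional set in a null set.
  There the restrictions of \<open>f\<close> and \<open>g\<close> agree almost everywhere, so they
  pass the test in \<open>steiner\<close> together and have the same rearrangement; measurability
  passes from \<open>g\<close> to \<open>f\<close> by completeness of Lebesgue measure.\<close>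

lemma steiner_AE_cong:
  fixes u :: "'a::euclidean_space" and f g :: "'a \<Rightarrow> real"
  assumes [measurable]: "g \<in> borel_measurable borel" and eq: "AE x in lborel. f x = g x"
  shows "AE x in lborel. steiner u f x = steiner u g x"
proof -
  obtain N where N: "N \<in> null_sets lborel" and fg: "\<And>x. x \<notin> N \<Longrightarrow> f x = g x"
    using AE_E3 [OF eq] by auto
  have [measurable]: "N \<in> sets borel" using N by auto
  from AE_line_emeasure_0 [OF N, of u] show ?thesis
  proof (rule eventually_mono)
    fix x assume x: "line_emeasure u N x = 0"
    define \<xi> where "\<xi> = x - (x \<bullet> u) *\<^sub>R u"
    define hf where "hf = (\<lambda>t::real. f (\<xi> + t *\<^sub>R u))"
    define hg where "hg = (\<lambda>t::real. g (\<xi> + t *\<^sub>R u))"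
    have "line_emeasure u N \<xi> = 0"
      using x line_emeasure_shift [of N u x "- (x \<bullet> u)"] by (simp add: \<xi>_def)
    then have "{t. \<xi> + t *\<^sub>R u \<in> N} \<in> null_sets lborel"
      by (simp add: line_emeasure_def null_sets_def line_sets)
    then have h_eq: "AE t in lborel. hf t = hg t"
      using fg by (auto simp: hf_def hg_def intro!: AE_I')
    have hg: "hg \<in> borel_measurable lebesgue"
    proof -
      have "hg \<in> borel_measurable borel" unfolding hg_def by measurable
      then show ?thesis by (simp add: measurable_completion)
    qed
    have "hf \<in> borel_measurable lebesgue" by (rule borel_measurable_lebesgue_AE_cong [OF hg h_eq])
    moreover have "vanishes_at_infinity hf \<longleftrightarrow> vanishes_at_infinity hg"
      unfolding vanishes_at_infinity_def emeasure_superlevel_AE_cong [OF hg h_eq] ..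
    ultimately show "steiner u f x = steiner u g x"
      using hg symm_rearr_AE_cong [OF hg h_eq]
      by (simp add: steiner_def Let_def hf_def hg_def \<xi>_def)
  qed
qed

lemma steiner_iter_AE_cong:
  assumes "admissible L C g" "AE x in lborel. f x = g x" "\<And>u. u \<in> set us \<Longrightarrow> norm u = 1"
  shows "AE x in lborel. steiner_iter us f x = steiner_iter us g x"
  using assms
proof (induction us arbitrary: f g)
  case (Cons u us)
  have "AE x in lborel. steiner u f x = steiner u g x"
    using Cons.prems by (intro steiner_AE_cong) (auto intro: admissibleD)
  with Cons.IH [of "steiner u g" "steiner u f"] show ?case
    using Cons.prems admissible_steiner [of L C g u] by (simp add: steiner_iter_def)
qed (simp add: steiner_iter_def)

text \<open>A Borel representative is truncated to values in \<open>[0, C]\<close> and cut off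
  outside the ball; both changes concern a null set only.\<close>

lemma ex_admissible_AE_eq:
  fixes f :: "'a::euclidean_space \<Rightarrow> real"
  assumes f: "f \<in> borel_measurable lebesgue" and "\<And>x. 0 \<le> f x" "0 \<le> L" "0 \<le> C"
    and "AE x in lborel. f x \<le> C" and supp: "{x. f x \<noteq> 0} \<subseteq> cball 0 L"
  obtains g where "admissible L C g" "AE x in lborel. f x = g x"
proof -
  obtain g' where [measurable]: "g' \<in> borel_measurable lborel" and g': "AE x in lborel. f x = g' x"
    using completion_ex_borel_measurable_real [OF f] by blast
  define g where "g x = indicator (cball 0 L) x * max 0 (min C (g' x))" for x
  have "admissible L C g"
    unfolding admissible_def
  proof (intro conjI)
    have [measurable]: "cball (0::'a) L \<in> sets borel" "g' \<in> borel_measurable borel" by auto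
    show "g \<in> borel_measurable borel" unfolding g_def by measurable
  qed (use assms in \<open>auto simp: g_def indicator_def\<close>)
  moreover have "AE x in lborel. f x = g x"
    using g' assms(5)
  proof eventually_elim
    case (elim x)
    show ?case
    proof (cases "x \<in> cball 0 L")
      case True
      then show ?thesis using elim assms(2) [of x] by (simp add: g_def)
    next
      case False
      then show ?thesis using supp by (auto simp: g_def)
    qed
  qed
  ultimately show ?thesis by (rule that)
qed

text \<open>The essential supremum exceeds \<open>y\<close> exactly when the superlevel set at
  \<open>y\<close> has positive measure, and the measure of a section depends measurably on the
  outcome.\<close>

lemma borel_measurable_esssup_lborel:
  fixes h :: "'w \<Rightarrow> 'a::euclidean_space \<Rightarrow> ennreal"
  assumes h: "(\<lambda>(\<omega>, x). h \<omega> x) \<in> borel_measurable (M \<Otimes>\<^sub>M lborel)"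
  shows "(\<lambda>\<omega>. esssup lebesgue (h \<omega>)) \<in> borel_measurable M"
proof (rule borel_measurableI_greater)
  fix y
  define Q where "Q = {z \<in> space (M \<Otimes>\<^sub>M lborel). y < (\<lambda>(\<omega>, x). h \<omega> x) z}"
  have "Q \<in> sets (M \<Otimes>\<^sub>M lborel)" unfolding Q_def using h by measurable
  then have [measurable]: "(\<lambda>\<omega>. emeasure lborel (Pair \<omega> -` Q)) \<in> borel_measurable M"
    by (rule lborel.measurable_emeasure_Pair)
  have "y < esssup lebesgue (h \<omega>) \<longleftrightarrow> emeasure lborel (Pair \<omega> -` Q) \<noteq> 0" if \<omega>: "\<omega> \<in> space M" for \<omega>
  proof -
    have m: "h \<omega> \<in> borel_measurable lborel"
      using measurable_Pair2 [OF h \<omega>] by simp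
    then have ml: "h \<omega> \<in> borel_measurable lebesgue" by (rule measurable_completion)
    have Q: "Pair \<omega> -` Q = {x. y < h \<omega> x}" using \<omega> by (auto simp: Q_def space_pair_measure)
    have "{x \<in> space lborel. y < h \<omega> x} \<in> sets lborel" using m by measurable
    then have "emeasure lborel (Pair \<omega> -` Q) = 0 \<longleftrightarrow> (AE x in lborel. \<not> y < h \<omega> x)"
      unfolding Q by (subst AE_iff_measurable [where N = "{x. y < h \<omega> x}"]) auto
    also have "\<dots> \<longleftrightarrow> esssup lebesgue (h \<omega>) \<le> y"
    proof
      assume "AE x in lborel. \<not> y < h \<omega> x"
      then show "esssup lebesgue (h \<omega>) \<le> y"
        using ml by (intro esssup_I) (auto simp: AE_completion_iff not_less)
    next
      assume "esssup lebesgue (h \<omega>) \<le> y"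
      with esssup_AE [of "h \<omega>" lebesgue] have "AE x in lebesgue. \<not> y < h \<omega> x"
        by (auto simp: not_less elim!: eventually_mono)
      then show "AE x in lborel. \<not> y < h \<omega> x" by (simp add: AE_completion_iff)
    qed
    finally show ?thesis by auto
  qed
  then have "{\<omega> \<in> space M. y < esssup lebesgue (h \<omega>)} = {\<omega> \<in> space M. emeasure lborel (Pair \<omega> -` Q) \<noteq> 0}"
    by auto
  also have "\<dots> \<in> sets M" by measurable
  finally show "{\<omega> \<in> space M. y < esssup lebesgue (h \<omega>)} \<in> sets M" .
qed

context random_directions
begin

context
  fixes g :: "'a \<Rightarrow> real" and L C :: real
  assumes g: "admissible L C g" and L: "0 < L"
begin

lemma borel_measurable_diff_dirs:
  "(\<lambda>(\<omega>, x). ennreal \<bar>steiner_iter (dirs n \<omega>) g x - symm_rearr g x\<bar>) \<in> borel_measurable (M \<Otimes>\<^sub>M lborel)"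
proof -
  define F where "F = (\<lambda>(\<omega>, x). steiner_iter (dirs n \<omega>) g x)"
  have [measurable]: "F \<in> borel_measurable (M \<Otimes>\<^sub>M lborel)" "symm_rearr g \<in> borel_measurable lborel"
    using borel_measurable_steiner_iter_dirs [OF g L] borel_measurable_rearr [OF g L]
    by (simp_all add: F_def cong: measurable_cong_sets sets_pair_measure_cong)
  have "(\<lambda>z. ennreal \<bar>F z - symm_rearr g (snd z)\<bar>) \<in> borel_measurable (M \<Otimes>\<^sub>M lborel)" by measurable
  then show ?thesis by (simp add: F_def case_prod_beta)
qed

lemma borel_measurable_L1_norm_dirs:
  "(\<lambda>\<omega>. L1_norm (\<lambda>x. steiner_iter (dirs n \<omega>) g x - symm_rearr g x)) \<in> borel_measurable M"
  unfolding L1_norm_def nn_integral_completion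
  using lborel.borel_measurable_nn_integral [OF borel_measurable_diff_dirs] .

lemma borel_measurable_Linf_norm_dirs:
  "(\<lambda>\<omega>. Linf_norm (\<lambda>x. steiner_iter (dirs n \<omega>) g x - symm_rearr g x)) \<in> borel_measurable M"
  unfolding Linf_norm_def by (rule borel_measurable_esssup_lborel [OF borel_measurable_diff_dirs])

end

end

section \<open>Hoelder continuity\<close>

definition hoelder :: "real \<Rightarrow> real \<Rightarrow> ('a::real_normed_vector \<Rightarrow> real) \<Rightarrow> bool" where
  "hoelder c \<alpha> f \<longleftrightarrow> (\<forall>x y. \<bar>f x - f y\<bar> \<le> c * norm (x - y) powr \<alpha>)"

lemma hoelderD: "hoelder c \<alpha> f \<Longrightarrow> \<bar>f x - f y\<bar> \<le> c * norm (x - y) powr \<alpha>"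
  by (simp add: hoelder_def)

lemma hoelder_of_modulus:
  fixes f :: "'a::euclidean_space \<Rightarrow> real"
  assumes c: "0 < c" and mod: "\<And>\<delta>. 0 < \<delta> \<Longrightarrow> modulus_of_continuity f \<delta> \<le> ennreal (c * \<delta> powr \<alpha>)"
  shows "hoelder c \<alpha> f"
  unfolding hoelder_def
proof (intro allI)
  fix x y :: 'a
  show "\<bar>f x - f y\<bar> \<le> c * norm (x - y) powr \<alpha>"
  proof (cases "x = y")
    case False
    have "ennreal \<bar>f x - f y\<bar> \<le> modulus_of_continuity f (norm (x - y))"
      unfolding modulus_of_continuity_def by (rule SUP_upper2 [where i = "(x, y)"]) auto
    also have "\<dots> \<le> ennreal (c * norm (x - y) powr \<alpha>)" using False by (intro mod) simp
    finally show ?thesis using c by simp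
  qed simp
qed

text \<open>One-dimensional Brunn--Minkowski with an interval: split \<open>A\<close> at any of its points and push
  the two halves apart.\<close>

lemma emeasure_enlarge_ge:
  fixes A A' :: "real set"
  assumes [measurable]: "A \<in> sets borel" "A' \<in> sets borel"
    and m: "m \<in> A" and \<rho>: "0 \<le> \<rho>" and enl: "\<And>s r. s \<in> A \<Longrightarrow> \<bar>r\<bar> \<le> \<rho> \<Longrightarrow> s + r \<in> A'"
  shows "emeasure lborel A + ennreal (2 * \<rho>) \<le> emeasure lborel A'"
proof -
  have shift: "emeasure lborel B = emeasure lborel {x. c + x \<in> B}" "{x. c + x \<in> B} \<in> sets borel"
    if [measurable]: "B \<in> sets borel" for B :: "real set" and c
  proof -
    have "(+) c -` B \<inter> space borel \<in> sets borel" by measurable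
    then show "{x. c + x \<in> B} \<in> sets borel" by (simp add: vimage_def)
    have "emeasure lborel B = emeasure (distr lborel borel ((+) c)) B" by (simp add: lborel_distr_plus)
    also have "\<dots> = emeasure lborel ((+) c -` B \<inter> space lborel)" by (rule emeasure_distr) auto
    finally show "emeasure lborel B = emeasure lborel {x. c + x \<in> B}" by (simp add: vimage_def)
  qed
  \<comment> \<open>The part of \<open>A\<close> below \<open>m\<close> moves left by
    \<open>\<rho>\<close>, the part above moves right, and the gap left between them is
    \<open>{m - \<rho>..m + \<rho>}\<close>.\<close>
  define P where "P = {x. \<rho> + x \<in> A \<inter> {..<m}}"
  define Q where "Q = {x. - \<rho> + x \<in> A \<inter> {m<..}}"
  have [measurable]: "P \<in> sets borel" "Q \<in> sets borel"
    unfolding P_def Q_def by (auto intro!: shift(2))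
  have "emeasure lborel A = emeasure lborel (A \<inter> {..<m} \<union> A \<inter> {m<..} \<union> {m})"
    using m by (intro arg_cong [where f = "emeasure lborel"]) auto
  also have "\<dots> = emeasure lborel (A \<inter> {..<m} \<union> A \<inter> {m<..})"
    by (subst plus_emeasure [symmetric]) auto
  also have "\<dots> = emeasure lborel (A \<inter> {..<m}) + emeasure lborel (A \<inter> {m<..})"
    by (subst plus_emeasure) auto
  also have "\<dots> = emeasure lborel P + emeasure lborel Q"
    using shift(1) [of "A \<inter> {..<m}" \<rho>] shift(1) [of "A \<inter> {m<..}" "- \<rho>"] by (simp add: P_def Q_def)
  finally have "emeasure lborel A + ennreal (2 * \<rho>) =
      emeasure lborel P + emeasure lborel Q + emeasure lborel {m - \<rho>..m + \<rho>}"
    using \<rho> by simp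
  also have "\<dots> = emeasure lborel (P \<union> Q \<union> {m - \<rho>..m + \<rho>})"
  proof -
    have "P \<inter> Q = {}" "(P \<union> Q) \<inter> {m - \<rho>..m + \<rho>} = {}" using \<rho> by (auto simp: P_def Q_def)
    then show ?thesis
      using plus_emeasure [of P lborel Q] plus_emeasure [of "P \<union> Q" lborel "{m - \<rho>..m + \<rho>}"] by simp
  qed
  also have "\<dots> \<le> emeasure lborel A'"
  proof (intro emeasure_mono)
    show "P \<union> Q \<union> {m - \<rho>..m + \<rho>} \<subseteq> A'"
    proof
      fix x assume "x \<in> P \<union> Q \<union> {m - \<rho>..m + \<rho>}"
      then consider "\<rho> + x \<in> A" | "- \<rho> + x \<in> A" | "\<bar>x - m\<bar> \<le> \<rho>" by (auto simp: P_def Q_def)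
      then show "x \<in> A'"
      proof cases
        case 1 then show ?thesis using enl [of "\<rho> + x" "- \<rho>"] \<rho> by simp
      next
        case 2 then show ?thesis using enl [of "- \<rho> + x" \<rho>] \<rho> by simp
      next
        case 3 then show ?thesis using enl [OF m, of "x - m"] by simp
      qed
    qed
  qed simp
  finally show ?thesis .
qed

text \<open>Let \<open>a\<close> and \<open>b\<close> be the heights of \<open>x\<close> and
  \<open>y\<close> along \<open>u\<close>. Points of the two lines whose heights differ by at most
  \<open>\<bar>a - b\<bar>\<close> are no farther apart than \<open>x\<close> and \<open>y\<close>.
  Hence the slice of \<open>{g > t}\<close> through \<open>x\<close>, enlarged by
  \<open>\<bar>a - b\<bar>\<close>, lies in the slice of \<open>{g > t - \<eta>}\<close> through
  \<open>y\<close>. If the former is longer than \<open>2 \<bar>a\<bar>\<close>, the latter is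
  longer than \<open>2 \<bar>b\<bar>\<close>, which is the claim at \<open>y\<close>.\<close>

lemma hoelder_steiner:
  fixes u :: "'a::euclidean_space"
  assumes g: "admissible L C g" and u: "norm u = 1" and h: "hoelder c \<alpha> g" and c: "0 < c" and \<alpha>: "0 < \<alpha>"
  shows "hoelder c \<alpha> (steiner u g)"
proof -
  have [measurable]: "g \<in> borel_measurable borel" by (rule admissibleD [OF g])
  have uu: "u \<bullet> u = 1" using u by (simp add: dot_square_norm)
  have le: "steiner u g x \<le> steiner u g y + c * norm (x - y) powr \<alpha>" for x y
  proof (rule ccontr)
    define \<eta> where "\<eta> = c * norm (x - y) powr \<alpha>"
    have \<eta>: "0 \<le> \<eta>" using c by (simp add: \<eta>_def)
    assume "\<not> ?thesis"
    then obtain t where t: "steiner u g y + \<eta> < t" "t < steiner u g x"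
      unfolding \<eta>_def [symmetric] not_le using dense by blast
    \<comment> \<open>\<open>steiner_less_iff\<close> will be used at both levels, so both must be
      positive.\<close>
    have tpos: "0 < t - \<eta>" "0 < t" using t \<eta> steiner_nonneg [OF g u, of y] by linarith+
    define a where "a = x \<bullet> u"
    define b where "b = y \<bullet> u"
    define w where "w = (x - a *\<^sub>R u) - (y - b *\<^sub>R u)"
    define A where "A = {s. (x - a *\<^sub>R u) + s *\<^sub>R u \<in> {z. t < g z}}"
    define A' where "A' = {s. (y - b *\<^sub>R u) + s *\<^sub>R u \<in> {z. t - \<eta> < g z}}"
    have [measurable]: "A \<in> sets borel" "A' \<in> sets borel"
      unfolding A_def A'_def by (intro line_sets sets_superlevel; simp)+
    have eA: "line_emeasure u {z. t < g z} x = emeasure lborel A"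
      using line_emeasure_shift [of "{z. t < g z}" u x "- a"]
      by (simp add: line_emeasure_def A_def sets_superlevel)
    have eA': "line_emeasure u {z. t - \<eta> < g z} y = emeasure lborel A'"
      using line_emeasure_shift [of "{z. t - \<eta> < g z}" u y "- b"]
      by (simp add: line_emeasure_def A'_def sets_superlevel)
    have xy: "norm (w - r *\<^sub>R u) \<le> norm (x - y)" if "\<bar>r\<bar> \<le> \<bar>a - b\<bar>" for r
    proof -
      have wu: "w \<bullet> u = 0" by (simp add: w_def a_def b_def inner_diff_left uu)
      have sq: "(norm (w - s *\<^sub>R u))\<^sup>2 = (norm w)\<^sup>2 + s\<^sup>2" for s
        unfolding power2_norm_eq_inner using wu
        by (simp add: inner_diff_left inner_diff_right inner_commute [of u w] uu power2_eq_square)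
      have "x - y = w - (b - a) *\<^sub>R u" by (simp add: w_def algebra_simps)
      moreover have "r\<^sup>2 \<le> (b - a)\<^sup>2" using that by (simp add: abs_le_square_iff [symmetric] abs_minus_commute)
      ultimately have "(norm (w - r *\<^sub>R u))\<^sup>2 \<le> (norm (x - y))\<^sup>2" by (simp add: sq)
      then show ?thesis by (rule power2_le_imp_le) simp
    qed
    have "ennreal (2 * \<bar>a\<bar>) < emeasure lborel A"
      using steiner_less_iff [OF g u tpos(2), of x] t(2) eA by (simp add: a_def)
    then have "A \<noteq> {}" by auto
    then obtain m where m: "m \<in> A" by blast
    have "emeasure lborel A + ennreal (2 * \<bar>a - b\<bar>) \<le> emeasure lborel A'"
    proof (rule emeasure_enlarge_ge [OF _ _ m])
      fix s r assume s: "s \<in> A" and r: "\<bar>r\<bar> \<le> \<bar>a - b\<bar>"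
      let ?p = "(x - a *\<^sub>R u) + s *\<^sub>R u" and ?q = "(y - b *\<^sub>R u) + (s + r) *\<^sub>R u"
      have "?p - ?q = w - r *\<^sub>R u" by (simp add: w_def algebra_simps)
      then have "norm (?p - ?q) \<le> norm (x - y)" using xy [OF r] by simp
      then have "c * norm (?p - ?q) powr \<alpha> \<le> \<eta>"
        unfolding \<eta>_def using c \<alpha> by (intro mult_left_mono powr_mono2) auto
      with hoelderD [OF h, of ?p ?q] have "\<bar>g ?p - g ?q\<bar> \<le> \<eta>" by (rule order_trans)
      moreover have "t < g ?p" using s by (simp add: A_def)
      ultimately have "t - \<eta> < g ?q" by linarith
      then show "s + r \<in> A'" by (simp add: A'_def)
    qed auto
    moreover have "ennreal (2 * \<bar>b\<bar>) < emeasure lborel A + ennreal (2 * \<bar>a - b\<bar>)"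
    proof -
      have "ennreal (2 * \<bar>b\<bar>) \<le> ennreal (2 * \<bar>a\<bar> + 2 * \<bar>a - b\<bar>)" 
        using abs_triangle_ineq2_sym [of b a] by (intro ennreal_leI) simp
      also have "\<dots> = ennreal (2 * \<bar>a\<bar>) + ennreal (2 * \<bar>a - b\<bar>)" by simp
      also have "\<dots> < emeasure lborel A + ennreal (2 * \<bar>a - b\<bar>)"
        using \<open>ennreal (2 * \<bar>a\<bar>) < emeasure lborel A\<close>
        unfolding add.commute [of _ "ennreal (2 * \<bar>a - b\<bar>)"] by (simp add: ennreal_add_left_cancel_less)
      finally show ?thesis .
    qed
    ultimately have "t - \<eta> < steiner u g y"
      using steiner_less_iff [OF g u tpos(1), of y] eA' by (simp add: b_def)
    then show False using t(1) by linarith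
  qed
  show ?thesis
    unfolding hoelder_def
  proof (intro allI)
    fix x y :: 'a
    show "\<bar>steiner u g x - steiner u g y\<bar> \<le> c * norm (x - y) powr \<alpha>"
      using le [of x y] le [of y x] by (simp add: norm_minus_commute abs_le_iff)
  qed
qed

lemma hoelder_steiner_iter:
  assumes "admissible L C g" "hoelder c \<alpha> g" "0 < c" "0 < \<alpha>" "\<And>u. u \<in> set us \<Longrightarrow> norm u = 1"
  shows "hoelder c \<alpha> (steiner_iter us g)"
  using assms
proof (induction us arbitrary: g)
  case (Cons u us)
  then show ?case
    using Cons.IH [of "steiner u g"] hoelder_steiner [of L C g u c \<alpha>] admissible_steiner [of L C g u]
    by (simp add: steiner_iter_def)
qed (simp add: steiner_iter_def)

lemma hoelder_borel_measurable:
  fixes f :: "'a::euclidean_space \<Rightarrow> real"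
  assumes h: "hoelder c \<alpha> f" and "0 < \<alpha>"
  shows "f \<in> borel_measurable borel"
proof (rule borel_measurable_continuous_onI, rule continuous_at_imp_continuous_on, rule ballI)
  fix x :: 'a
  have "((\<lambda>y. c * norm (y - x) powr \<alpha>) \<longlongrightarrow> c * norm (x - x) powr \<alpha>) (at x)"
    using \<open>0 < \<alpha>\<close> by (intro tendsto_intros) auto
  then have lim: "((\<lambda>y. c * norm (y - x) powr \<alpha>) \<longlongrightarrow> 0) (at x)" by simp
  have "norm (f y - f x) \<le> c * norm (y - x) powr \<alpha>" for y using hoelderD [OF h, of y x] by simp
  then have "((\<lambda>y. f y - f x) \<longlongrightarrow> 0) (at x)"
    by (intro Lim_null_comparison [OF _ lim] always_eventually allI)
  then show "isCont f x" by (simp add: isCont_def LIM_zero_iff)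
qed

text \<open>Of two antipodal points at distance \<open>2 L\<close> from \<open>x\<close>, at least
  one lies outside the support. The modulus at distance \<open>2 L\<close> then bounds
  \<open>f x\<close>, and \<open>(2 L)^\<alpha> <= 2 L^\<alpha>\<close>.\<close>

lemma hoelder_bounded:
  fixes f :: "'a::euclidean_space \<Rightarrow> real"
  assumes h: "hoelder c \<alpha> f" and supp: "\<And>x. L < norm x \<Longrightarrow> f x = 0" and L: "0 < L"
    and c: "0 < c" and \<alpha>: "0 < \<alpha>" "\<alpha> \<le> 1"
  shows "f x \<le> 2 * c * L powr \<alpha>"
proof -
  obtain b :: 'a where b: "norm b = 1" using norm_Basis nonempty_Basis by blast
  have "4 * L = norm ((x + (2 * L) *\<^sub>R b) - (x - (2 * L) *\<^sub>R b))"
    using b L by (simp add: scaleR_add_left [symmetric])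
  also have "\<dots> \<le> norm (x + (2 * L) *\<^sub>R b) + norm (x - (2 * L) *\<^sub>R b)" by (rule norm_triangle_ineq4)
  finally obtain y where y: "L < norm y" "norm (x - y) = 2 * L"
    using L b
    by (cases "L < norm (x + (2 * L) *\<^sub>R b)") (auto intro: that [of "x + (2 * L) *\<^sub>R b"] that [of "x - (2 * L) *\<^sub>R b"])
  have "(2::real) powr \<alpha> \<le> 2 powr 1" using \<alpha> by (intro powr_mono) auto
  have "f x \<le> c * (2 * L) powr \<alpha>" using hoelderD [OF h, of x y] supp [OF y(1)] y(2) by simp
  also have "\<dots> = c * L powr \<alpha> * 2 powr \<alpha>" using L by (simp add: powr_mult)
  also have "\<dots> \<le> c * L powr \<alpha> * 2"
    using \<open>2 powr \<alpha> \<le> 2 powr 1\<close> c by (intro mult_left_mono) auto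
  finally show ?thesis by simp
qed

text \<open>For \<open>y\<close> within \<open>\<rho>\<close> of \<open>x\<close> the two moduli
  give \<open>|F x - G x| <= 2 c \<rho>^\<alpha> + |F y - G y|\<close>; this is averaged over
  \<open>y\<close> in the ball. \<open>G\<close> is controlled only on a set of full measure since
  it will be the rearrangement, known as an almost everywhere limit.\<close>

lemma Linf_norm_hoelder_le:
  fixes F G :: "'a::euclidean_space \<Rightarrow> real"
  assumes [measurable]: "F \<in> borel_measurable borel" "G \<in> borel_measurable borel"
    and F: "hoelder c \<alpha> F" and P: "AE x in lborel. P x"
    and G: "\<And>x y. P x \<Longrightarrow> P y \<Longrightarrow> \<bar>G x - G y\<bar> \<le> c * norm (x - y) powr \<alpha>"
    and \<rho>: "0 < \<rho>" and c: "0 < c" and \<alpha>: "0 < \<alpha>"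
  shows "Linf_norm (\<lambda>x. F x - G x) \<le> ennreal (2 * c * \<rho> powr \<alpha>) +
    ennreal (1 / measure lborel (ball (0::'a) \<rho>)) * L1_norm (\<lambda>x. F x - G x)"
proof -
  define m where "m = measure lborel (ball (0::'a) \<rho>)"
  have m: "0 < m" using \<rho> unit_ball_vol_pos [of "real DIM('a)"] by (simp add: m_def content_ball)
  have eball: "emeasure lborel (ball x \<rho>) = ennreal m" for x :: 'a
    using \<rho> by (simp add: m_def content_ball emeasure_ball)
  let ?d = "\<lambda>x. ennreal \<bar>F x - G x\<bar>"
  have L1: "L1_norm (\<lambda>x. F x - G x) = (\<integral>\<^sup>+x. ?d x \<partial>lborel)"
    unfolding L1_norm_def by (rule nn_integral_completion)
  have "?d x \<le> ennreal (2 * c * \<rho> powr \<alpha>) + ennreal (1 / m) * L1_norm (\<lambda>x. F x - G x)" if x: "P x" for x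
  proof -
    have [measurable]: "ball x \<rho> \<in> sets borel" by simp
    have "?d x * ennreal m = (\<integral>\<^sup>+y. ?d x * indicator (ball x \<rho>) y \<partial>lborel)"
      by (simp add: nn_integral_cmult eball)
    also have "\<dots> \<le> (\<integral>\<^sup>+y. ennreal (2 * c * \<rho> powr \<alpha>) * indicator (ball x \<rho>) y + ?d y \<partial>lborel)"
    proof (rule nn_integral_mono_AE, rule eventually_mono [OF P])
      fix y assume y: "P y"
      show "?d x * indicator (ball x \<rho>) y \<le> ennreal (2 * c * \<rho> powr \<alpha>) * indicator (ball x \<rho>) y + ?d y"
      proof (cases "y \<in> ball x \<rho>")
        case True
        then have "norm (x - y) \<le> \<rho>" by (simp add: dist_norm)
        then have "c * norm (x - y) powr \<alpha> \<le> c * \<rho> powr \<alpha>"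
          using c \<alpha> by (intro mult_left_mono powr_mono2) auto
        then have "\<bar>F x - G x\<bar> \<le> 2 * c * \<rho> powr \<alpha> + \<bar>F y - G y\<bar>"
          using hoelderD [OF F, of x y] G [OF x y] by linarith
        then have "?d x \<le> ennreal (2 * c * \<rho> powr \<alpha> + \<bar>F y - G y\<bar>)" by (rule ennreal_leI)
        also have "\<dots> = ennreal (2 * c * \<rho> powr \<alpha>) + ?d y" using c by (intro ennreal_plus) auto
        finally show ?thesis using True by simp
      qed simp
    qed
    also have "\<dots> = ennreal (2 * c * \<rho> powr \<alpha>) * ennreal m + L1_norm (\<lambda>x. F x - G x)"
      by (subst nn_integral_add) (simp_all add: nn_integral_cmult eball L1)
    finally have "ennreal (1 / m) * (?d x * ennreal m) \<le>
        ennreal (1 / m) * (ennreal (2 * c * \<rho> powr \<alpha>) * ennreal m + L1_norm (\<lambda>x. F x - G x))"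
      by (rule mult_left_mono) simp
    moreover have "ennreal (1 / m) * (z * ennreal m) = z" for z
    proof -
      have "ennreal (1 / m) * ennreal m = 1" using m by (simp flip: ennreal_mult)
      then show ?thesis by (metis mult.assoc mult.commute mult.right_neutral)
    qed
    ultimately show ?thesis by (simp add: distrib_left)
  qed
  then have "AE x in lborel. ?d x \<le> ennreal (2 * c * \<rho> powr \<alpha>) + ennreal (1 / m) * L1_norm (\<lambda>x. F x - G x)"
    by (rule eventually_mono [OF P])
  moreover have "?d \<in> borel_measurable lebesgue"
  proof -
    have "?d \<in> borel_measurable lborel" by measurable
    then show ?thesis by (rule measurable_completion)
  qed
  ultimately show ?thesis
    unfolding Linf_norm_def m_def by (intro esssup_I) (auto simp: AE_completion_iff)
qed

section \<open>Modulus of the rearrangement and the expected sup distance\<close>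

context random_directions
begin

context
  fixes g :: "'a \<Rightarrow> real" and L C :: real
  assumes g: "admissible L C g" and L: "0 < L"
begin

text \<open>The rearrangement inherits the modulus of continuity from its Steiner approximations; the
  isoperimetric inequality is not needed.\<close>

lemma hoelder_symm_rearr_AE:
  assumes h: "hoelder c \<alpha> g" and c: "0 < c" and \<alpha>: "0 < \<alpha>"
  obtains P where "AE x in lborel. P x"
    "\<And>x y. P x \<Longrightarrow> P y \<Longrightarrow> \<bar>symm_rearr g x - symm_rearr g y\<bar> \<le> c * norm (x - y) powr \<alpha>"
proof -
  define K where "K = real DIM('a) * measure lebesgue (ball (0::'a) (2 * L))"
  have KC: "0 \<le> K * C" using admissibleD(3) [OF g] by (simp add: K_def)
  let ?D = "\<lambda>n \<omega> x. steiner_iter (dirs n \<omega>) g x - symm_rearr g x"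
  \<comment> \<open>Some outcome does not exceed the mean by much; the added 1 provides the strict
    gap for the contradiction.\<close>
  have "\<exists>\<omega>\<in>space M. L1_norm (?D (Suc n) \<omega>) \<le> ennreal ((K * C + 1) / real (Suc n))" for n
  proof (rule ccontr)
    assume "\<not> ?thesis"
    then have "ennreal ((K * C + 1) / real (Suc n)) \<le> L1_norm (?D (Suc n) \<omega>)" if "\<omega> \<in> space M" for \<omega>
      using that by (auto simp: not_le intro: less_imp_le)
    then have "(\<integral>\<^sup>+\<omega>. ennreal ((K * C + 1) / real (Suc n)) \<partial>M) \<le> (\<integral>\<^sup>+\<omega>. L1_norm (?D (Suc n) \<omega>) \<partial>M)"
      by (rule nn_integral_mono)
    also have "\<dots> \<le> ennreal (K * C / real (Suc n))"
      using expected_L1_norm_le [OF g L, of "Suc n"] by (simp add: K_def)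
    finally have "(K * C + 1) / real (Suc n) \<le> K * C / real (Suc n)"
      using KC by (simp add: emeasure_space_1)
    then show False by (simp add: field_simps)
  qed
  then obtain w where w: "\<And>n. w n \<in> space M"
    "\<And>n. L1_norm (?D (Suc n) (w n)) \<le> ennreal ((K * C + 1) / real (Suc n))"
    by metis
  define F where "F n = steiner_iter (dirs (Suc n) (w n)) g" for n
  have F_adm: "admissible L C (F n)" for n unfolding F_def by (rule admissible_dirs [OF g L w(1)])
  have F_h: "hoelder c \<alpha> (F n)" for n
    unfolding F_def by (intro hoelder_steiner_iter [OF g h c \<alpha>] norm_dirs [OF w(1)])
  have m [measurable]: "F n \<in> borel_measurable borel" "symm_rearr g \<in> borel_measurable borel" for n
    using admissibleD(1) [OF F_adm] borel_measurable_rearr [OF g L] by auto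
  have L1: "(\<integral>\<^sup>+x. ennreal (norm (F n x - symm_rearr g x)) \<partial>lborel) \<le> ennreal ((K * C + 1) / real (Suc n))" for n
    using w(2) [of n] by (simp add: L1_norm_def nn_integral_completion F_def)
  have int: "integrable lborel (\<lambda>x. F n x - symm_rearr g x)" for n
    unfolding integrable_iff_bounded using L1 [of n] by (auto intro: le_less_trans [OF _ ennreal_less_top])
  have "(\<lambda>n. \<integral>x. norm (F n x - symm_rearr g x) \<partial>lborel) \<longlonglongrightarrow> 0"
  proof (rule tendsto_sandwich [OF _ _ tendsto_const])
    have "(\<integral>x. norm (F n x - symm_rearr g x) \<partial>lborel) \<le> (K * C + 1) / real (Suc n)" for n
    proof -
      have "ennreal (\<integral>x. norm (F n x - symm_rearr g x) \<partial>lborel) \<le> ennreal ((K * C + 1) / real (Suc n))"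
        using L1 [of n] int [of n] by (subst nn_integral_eq_integral [symmetric]) auto
      then show ?thesis using KC by (subst (asm) ennreal_le_iff) auto
    qed
    then show "\<forall>\<^sub>F n in sequentially. (\<integral>x. norm (F n x - symm_rearr g x) \<partial>lborel) \<le> (K * C + 1) / real (Suc n)"
      by (intro always_eventually allI)
    show "(\<lambda>n. (K * C + 1) / real (Suc n)) \<longlonglongrightarrow> 0"
      by (rule LIMSEQ_Suc, rule lim_const_over_n)
  qed (intro always_eventually allI, simp)
  \<comment> \<open>\<open>L^1\<close> convergence yields almost everywhere convergence along a
    subsequence, and \<open>P\<close> is the set of its convergence points: the modulus passes to
    the limit at any two of them.\<close>
  then obtain r where r: "strict_mono r" "AE x in lborel. (\<lambda>n. F (r n) x - symm_rearr g x) \<longlonglongrightarrow> 0"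
    using tendsto_L1_AE_subseq [of lborel "\<lambda>n x. F n x - symm_rearr g x", OF int] by blast
  show ?thesis
  proof (rule that [OF r(2)])
    fix x y
    assume "(\<lambda>n. F (r n) x - symm_rearr g x) \<longlonglongrightarrow> 0" "(\<lambda>n. F (r n) y - symm_rearr g y) \<longlonglongrightarrow> 0"
    then have "(\<lambda>n. \<bar>F (r n) x - F (r n) y\<bar>) \<longlonglongrightarrow> \<bar>symm_rearr g x - symm_rearr g y\<bar>"
      by (intro tendsto_rabs tendsto_diff) (auto simp: LIM_zero_iff)
    then show "\<bar>symm_rearr g x - symm_rearr g y\<bar> \<le> c * norm (x - y) powr \<alpha>"
      by (rule LIMSEQ_le_const2) (use hoelderD [OF F_h] in auto)
  qed
qed

lemma expected_Linf_norm_le: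
  fixes n :: nat and \<rho> :: real
  assumes h: "hoelder c \<alpha> g" and c: "0 < c" and \<alpha>: "0 < \<alpha>" and n: "1 \<le> n" and \<rho>: "0 < \<rho>"
  shows "(\<integral>\<^sup>+\<omega>. Linf_norm (\<lambda>x. steiner_iter (dirs n \<omega>) g x - symm_rearr g x) \<partial>M)
    \<le> ennreal (2 * c * \<rho> powr \<alpha> + real DIM('a) * (2 * L / \<rho>) ^ DIM('a) * C / real n)"
proof -
  let ?D = "\<lambda>\<omega> x. steiner_iter (dirs n \<omega>) g x - symm_rearr g x"
  obtain P where P: "AE x in lborel. P x"
    "\<And>x y. P x \<Longrightarrow> P y \<Longrightarrow> \<bar>symm_rearr g x - symm_rearr g y\<bar> \<le> c * norm (x - y) powr \<alpha>"
    using hoelder_symm_rearr_AE [OF h c \<alpha>] by blast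
  define v where "v = unit_ball_vol (real DIM('a))"
  have v: "0 < v" by (simp add: v_def)
  define m where "m = measure lborel (ball (0::'a) \<rho>)"
  have m: "m = v * \<rho> ^ DIM('a)" using \<rho> by (simp add: m_def v_def content_ball)
  have C: "0 \<le> C" by (rule admissibleD [OF g])
  have "Linf_norm (?D \<omega>) \<le> ennreal (2 * c * \<rho> powr \<alpha>) + ennreal (1 / m) * L1_norm (?D \<omega>)"
    if "\<omega> \<in> space M" for \<omega>
    unfolding m_def
    by (intro Linf_norm_hoelder_le [where P = P] hoelder_steiner_iter [OF g h c \<alpha>] norm_dirs [OF that]
        admissibleD(1) [OF admissible_dirs [OF g L that]] borel_measurable_rearr [OF g L] P \<rho> c \<alpha>)
  then have "(\<integral>\<^sup>+\<omega>. Linf_norm (?D \<omega>) \<partial>M) \<le>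
      (\<integral>\<^sup>+\<omega>. ennreal (2 * c * \<rho> powr \<alpha>) + ennreal (1 / m) * L1_norm (?D \<omega>) \<partial>M)"
    by (rule nn_integral_mono)
  also have "\<dots> = ennreal (2 * c * \<rho> powr \<alpha>) + ennreal (1 / m) * (\<integral>\<^sup>+\<omega>. L1_norm (?D \<omega>) \<partial>M)"
    using borel_measurable_L1_norm_dirs [OF g L, of n]
    by (subst nn_integral_add) (simp_all add: nn_integral_cmult emeasure_space_1)
  also have "\<dots> \<le> ennreal (2 * c * \<rho> powr \<alpha>) +
      ennreal (1 / m) * ennreal (real DIM('a) * measure lebesgue (ball (0::'a) (2 * L)) * C / real n)"
    by (intro add_left_mono mult_left_mono expected_L1_norm_le [OF g L n]) simp
  also have "\<dots> = ennreal (2 * c * \<rho> powr \<alpha> + 1 / m * (real DIM('a) * measure lebesgue (ball (0::'a) (2 * L)) * C / real n))"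
  proof -
    have "ennreal a + ennreal k * ennreal b = ennreal (a + k * b)" if "0 \<le> a" "0 \<le> k" "0 \<le> b" for a k b
      using that by (simp add: ennreal_mult)
    then show ?thesis using c C m v \<rho> by simp
  qed
  \<comment> \<open>The volume of the unit ball cancels, leaving a ratio of radii.\<close>
  also have "1 / m * (real DIM('a) * measure lebesgue (ball (0::'a) (2 * L)) * C / real n)
      = real DIM('a) * (2 * L / \<rho>) ^ DIM('a) * C / real n"
    using v \<rho> L by (simp add: m content_ball v_def [symmetric] power_divide)
  finally show ?thesis .
qed

end

end

text \<open>The radius \<open>4 L n\<^bsup>-1/(d+\<alpha>)\<^esup>\<close> balances the two error terms.\<close>

lemma hoelder_rate_bound:
  fixes c L \<alpha> :: real and n d :: nat
  assumes c: "0 < c" and L: "0 < L" and \<alpha>: "0 < \<alpha>" "\<alpha> \<le> 1" and n: "1 \<le> n" and d: "1 \<le> d"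
  defines "\<rho> \<equiv> 4 * L * real n powr (- (1 / (real d + \<alpha>)))"
  shows "2 * c * \<rho> powr \<alpha> + real d * (2 * L / \<rho>) ^ d * (2 * c * L powr \<alpha>) / real n
    \<le> 10 * c * L powr \<alpha> * real n powr (- (\<alpha> / (real d + \<alpha>)))"
proof -
  define s where "s = real n powr (- (1 / (real d + \<alpha>)))"
  define N where "N = real n powr (- (\<alpha> / (real d + \<alpha>)))"
  have s: "0 < s" using n by (simp add: s_def)
  have N: "0 < N" using n by (simp add: N_def)
  have d\<alpha>: "real d + \<alpha> > 0" using \<alpha> by simp
  have s\<alpha>: "s powr \<alpha> = N" by (simp add: s_def N_def powr_powr)
  have "4 powr \<alpha> \<le> (4::real) powr 1" using \<alpha> by (intro powr_mono) auto
  then have 4: "4 powr \<alpha> \<le> (4::real)" by simp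
  have "\<rho> powr \<alpha> = 4 powr \<alpha> * L powr \<alpha> * N"
    using L s by (simp add: \<rho>_def s_def [symmetric] powr_mult s\<alpha>)
  \<comment> \<open>\<open>4^\<alpha> <= 4\<close> as \<open>\<alpha> <= 1\<close>; with the factor
    2 this is the 8 in the final count \<open>8 + 1 <= 10\<close>.\<close>
  also have "\<dots> \<le> 4 * L powr \<alpha> * N" using 4 N by (intro mult_right_mono) auto
  finally have "2 * c * \<rho> powr \<alpha> \<le> 2 * c * (4 * L powr \<alpha> * N)" using c by (intro mult_left_mono) auto
  then have first: "2 * c * \<rho> powr \<alpha> \<le> 8 * (c * L powr \<alpha> * N)" by simp
  have sd: "(1 / s) ^ d / real n = N"
  proof -
    have "(1 / s) ^ d = real n powr (real d / (real d + \<alpha>))"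
      using n by (simp add: s_def powr_minus_divide powr_power)
    moreover have "real n = real n powr 1" using n by simp
    ultimately have "(1 / s) ^ d / real n = real n powr (real d / (real d + \<alpha>) - 1)"
      using n by (metis powr_diff)
    also have "real d / (real d + \<alpha>) - 1 = - (\<alpha> / (real d + \<alpha>))" using d\<alpha> by (simp add: field_simps)
    finally show ?thesis by (simp add: N_def)
  qed
  \<comment> \<open>With the 4 in the radius, \<open>2 L / \<rho>\<close> carries a factor 1/2 whose
    \<open>d\<close>-th power absorbs \<open>2 d\<close>; thus the constant is independent of the
    dimension.\<close>
  have "2 * real d \<le> 2 ^ d"
  proof -
    have "2 * k \<le> 2 ^ k" if "1 \<le> k" for k :: nat
      using that by (induction k rule: dec_induct) auto
    from this [OF d] have "real (2 * d) \<le> real (2 ^ d)" by (rule of_nat_mono)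
    then show ?thesis by simp
  qed
  then have d2: "2 * real d * (1 / 2) ^ d \<le> 1" by (simp add: power_divide)
  have "2 * L / \<rho> = 1 / 2 * (1 / s)" using L s by (simp add: \<rho>_def s_def [symmetric])
  then have "real d * (2 * L / \<rho>) ^ d * (2 * c * L powr \<alpha>) / real n
      = (2 * real d * (1 / 2) ^ d) * (c * L powr \<alpha> * ((1 / s) ^ d / real n))"
    by (simp only: power_mult_distrib) simp
  also have "\<dots> \<le> 1 * (c * L powr \<alpha> * N)"
    unfolding sd using d2 c N by (intro mult_right_mono) auto
  finally have "real d * (2 * L / \<rho>) ^ d * (2 * c * L powr \<alpha>) / real n \<le> c * L powr \<alpha> * N" by simp
  moreover have "0 \<le> c * L powr \<alpha> * N" using c N by simp
  moreover have "10 * c * L powr \<alpha> * N = 10 * (c * L powr \<alpha> * N)" by simp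
  ultimately show ?thesis unfolding N_def [symmetric] using first by linarith
qed

section \<open>Transfer to Lebesgue measurable functions\<close>

theorem corollary5p4:
  fixes M :: "'w measure"
    and U :: "nat \<Rightarrow> 'w \<Rightarrow> 'a::euclidean_space"
    and f :: "'a \<Rightarrow> real"
    and L :: real and n :: nat
  assumes "prob_space M"
    and "prob_space.indep_vars M (\<lambda>_. restrict_space borel (sphere 0 1)) U {1..}"
    and "\<And>i. i \<ge> 1 \<Longrightarrow> distr M (restrict_space borel (sphere 0 1)) (U i) = uniform_sphere"
    and "L > 0"
    and "n \<ge> 1"
    and "f \<in> borel_measurable lebesgue"
    and "\<And>x. 0 \<le> f x"
    and "bounded (range f)"
    and "closure {x. f x \<noteq> 0} \<subseteq> cball 0 L"
  defines "D \<equiv> (\<lambda>\<omega> x. steiner_iter (map (\<lambda>i. U i \<omega>) [1..<Suc n]) f x - symm_rearr f x)"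
  shows "(\<lambda>\<omega>. L1_norm (D \<omega>)) \<in> borel_measurable M \<and>
         (\<integral>\<^sup>+\<omega>. L1_norm (D \<omega>) \<partial>M)
           \<le> ennreal (2 * real DIM('a) * measure lebesgue (ball (0::'a) (2 * L)))
               * Linf_norm f * ennreal (1 / real n) \<and>
         (\<forall>c \<alpha>. c > 0 \<and> 0 < \<alpha> \<and> \<alpha> \<le> 1 \<and>
            (\<forall>\<delta>>0. modulus_of_continuity f \<delta> \<le> ennreal (c * \<delta> powr \<alpha>)) \<longrightarrow>
            (\<lambda>\<omega>. Linf_norm (D \<omega>)) \<in> borel_measurable M \<and>
            (\<integral>\<^sup>+\<omega>. Linf_norm (D \<omega>) \<partial>M)
              \<le> ennreal (10 * c * L powr \<alpha> * real n powr (- (\<alpha> / (real DIM('a) + \<alpha>)))))"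
proof -
  interpret random_directions M U
    using assms(1-3) by (simp add: random_directions_def random_directions_axioms_def)
  have supp: "{x. f x \<noteq> 0} \<subseteq> cball 0 L" using assms(9) closure_subset by (rule order_trans [rotated])
  obtain B where B: "\<And>x. f x \<le> B" "0 \<le> B"
    using assms(8) unfolding bounded_iff by (metis abs_ge_self abs_ge_zero order_trans rangeI real_norm_def)
  have abs_f: "(\<lambda>x. ennreal \<bar>f x\<bar>) \<in> borel_measurable lebesgue" using assms(6) by measurable
  have "Linf_norm f \<le> ennreal B"
    unfolding Linf_norm_def using B assms(7) by (intro esssup_I [OF abs_f]) (auto intro!: ennreal_leI)
  \<comment> \<open>\<open>C\<close> is the essential supremum itself, as the \<open>L^1\<close>
    bound is in terms of \<open>Linf_norm f\<close>; the pointwise bound \<open>B\<close> only shows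
    that it is finite.\<close>
  then obtain C where C: "0 \<le> C" "Linf_norm f = ennreal C"
    by (cases "Linf_norm f") (auto simp: top_unique)
  have "AE x in lborel. f x \<le> C"
  proof -
    have "AE x in lebesgue. ennreal \<bar>f x\<bar> \<le> ennreal C"
      using esssup_AE [of "\<lambda>x. ennreal \<bar>f x\<bar>" lebesgue] C(2) by (simp add: Linf_norm_def)
    then have "AE x in lborel. ennreal \<bar>f x\<bar> \<le> ennreal C" by (simp only: AE_completion_iff)
    then show ?thesis by (rule eventually_mono) (use C(1) assms(7) in auto)
  qed
  then obtain g where g: "admissible L C g" and fg: "AE x in lborel. f x = g x"
    using ex_admissible_AE_eq [OF assms(6,7) less_imp_le [OF assms(4)] C(1) _ supp] by blast
  have g_leb: "g \<in> borel_measurable lebesgue"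
    using admissibleD(1) [OF g] by (simp add: measurable_completion)
  have rearr: "symm_rearr f = symm_rearr g" by (rule symm_rearr_AE_cong [OF g_leb fg])
  let ?Dg = "\<lambda>\<omega> x. steiner_iter (dirs n \<omega>) g x - symm_rearr g x"
  have D_eq: "AE x in lborel. D \<omega> x = ?Dg \<omega> x" if "\<omega> \<in> space M" for \<omega>
    unfolding D_def rearr dirs_def [symmetric]
    by (rule eventually_mono [OF steiner_iter_AE_cong [OF g fg norm_dirs [OF that]]]) simp_all
  have Dg_leb: "?Dg \<omega> \<in> borel_measurable lebesgue" if "\<omega> \<in> space M" for \<omega>
    using admissibleD(1) [OF admissible_dirs [OF g assms(4) that]] borel_measurable_rearr [OF g assms(4)]
    by (intro borel_measurable_diff) (simp_all add: measurable_completion)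
  have L1_eq: "L1_norm (D \<omega>) = L1_norm (?Dg \<omega>)" if "\<omega> \<in> space M" for \<omega>
    unfolding L1_norm_def nn_integral_completion
    by (intro nn_integral_cong_AE eventually_mono [OF D_eq [OF that]]) simp
  have Linf_eq: "Linf_norm (D \<omega>) = Linf_norm (?Dg \<omega>)" if "\<omega> \<in> space M" for \<omega>
    unfolding Linf_norm_def
  proof (rule esssup_AE_cong)
    have "D \<omega> \<in> borel_measurable lebesgue"
      by (rule borel_measurable_lebesgue_AE_cong [OF Dg_leb [OF that] D_eq [OF that]])
    then show "(\<lambda>x. ennreal \<bar>D \<omega> x\<bar>) \<in> borel_measurable lebesgue" by measurable
    show "(\<lambda>x. ennreal \<bar>?Dg \<omega> x\<bar>) \<in> borel_measurable lebesgue" using Dg_leb [OF that] by measurable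
    show "AE x in lebesgue. ennreal \<bar>D \<omega> x\<bar> = ennreal \<bar>?Dg \<omega> x\<bar>"
      unfolding AE_completion_iff by (rule eventually_mono [OF D_eq [OF that]]) simp
  qed
  have L1_meas: "(\<lambda>\<omega>. L1_norm (D \<omega>)) \<in> borel_measurable M"
    using borel_measurable_L1_norm_dirs [OF g assms(4), of n] by (simp add: L1_eq cong: measurable_cong)
  have Linf_meas: "(\<lambda>\<omega>. Linf_norm (D \<omega>)) \<in> borel_measurable M"
    using borel_measurable_Linf_norm_dirs [OF g assms(4), of n] by (simp add: Linf_eq cong: measurable_cong)
  define K where "K = real DIM('a) * measure lebesgue (ball (0::'a) (2 * L))"
  have K: "0 \<le> K" by (simp add: K_def)
  have "(\<integral>\<^sup>+\<omega>. L1_norm (D \<omega>) \<partial>M) = (\<integral>\<^sup>+\<omega>. L1_norm (?Dg \<omega>) \<partial>M)"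
    by (intro nn_integral_cong L1_eq)
  also have "\<dots> \<le> ennreal (K * C / real n)"
    unfolding K_def by (rule expected_L1_norm_le [OF g assms(4,5)])
  \<comment> \<open>The level-set argument gives half the stated constant; the factor 2 is inserted
    here.\<close>
  also have "\<dots> \<le> ennreal (2 * K * C * (1 / real n))"
    using K C(1) by (intro ennreal_leI) (simp add: divide_right_mono)
  also have "\<dots> = ennreal (2 * K) * Linf_norm f * ennreal (1 / real n)"
    using K C by (simp only: ennreal_mult mult_nonneg_nonneg zero_le_numeral zero_le_divide_1_iff of_nat_0_le_iff)
  finally have L1_bound: "(\<integral>\<^sup>+\<omega>. L1_norm (D \<omega>) \<partial>M) \<le>
      ennreal (2 * real DIM('a) * measure lebesgue (ball (0::'a) (2 * L))) * Linf_norm f * ennreal (1 / real n)"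
    by (simp only: K_def mult.assoc)
  have Linf_bound: "(\<integral>\<^sup>+\<omega>. Linf_norm (D \<omega>) \<partial>M)
      \<le> ennreal (10 * c * L powr \<alpha> * real n powr (- (\<alpha> / (real DIM('a) + \<alpha>))))"
    if c: "0 < c" and \<alpha>: "0 < \<alpha>" "\<alpha> \<le> 1"
      and mod: "\<And>\<delta>. 0 < \<delta> \<Longrightarrow> modulus_of_continuity f \<delta> \<le> ennreal (c * \<delta> powr \<alpha>)" for c \<alpha>
  proof -
    have h: "hoelder c \<alpha> f" by (rule hoelder_of_modulus [OF c mod])
    have f0: "f x = 0" if "L < norm x" for x using supp that by force
    \<comment> \<open>A Hoelder function is continuous, hence Borel, so here \<open>f\<close> itself
      is admissible; its bound is expressed through \<open>c\<close> and \<open>L\<close>, as in the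
      claimed rate.\<close>
    have adm: "admissible L (2 * c * L powr \<alpha>) f"
      using hoelder_borel_measurable [OF h \<alpha>(1)] hoelder_bounded [OF h f0 assms(4) c \<alpha>] f0 c assms(4,7)
      by (simp add: admissible_def)
    define \<rho> where "\<rho> = 4 * L * real n powr (- (1 / (real DIM('a) + \<alpha>)))"
    have "0 < \<rho>" using assms(4,5) by (simp add: \<rho>_def)
    have "(\<integral>\<^sup>+\<omega>. Linf_norm (D \<omega>) \<partial>M) \<le>
        ennreal (2 * c * \<rho> powr \<alpha> + real DIM('a) * (2 * L / \<rho>) ^ DIM('a) * (2 * c * L powr \<alpha>) / real n)"
      using expected_Linf_norm_le [OF adm assms(4) h c \<alpha>(1) assms(5) \<open>0 < \<rho>\<close>] by (simp add: D_def dirs_def)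
    also have "\<dots> \<le> ennreal (10 * c * L powr \<alpha> * real n powr (- (\<alpha> / (real DIM('a) + \<alpha>))))"
      unfolding \<rho>_def using c assms(4,5) \<alpha> DIM_positive [where 'a = 'a]
      by (intro ennreal_leI hoelder_rate_bound) auto
    finally show ?thesis .
  qed
  show ?thesis using L1_meas L1_bound Linf_meas Linf_bound by blast
qed

end
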